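(* Let $A\sqcup B=\{1,\dots,p\}$ where, after relabeling, $A=\{1,\dots,|A|\}$ and $B=\{|A|+1,\dots,p\}$. The set of degree-one monomials and tetrads $$\{\sigma_{ij}\mid i\in B\text{ or }j\in B\}\cup\{\underline{\sigma_{ij}\sigma_{kl}}-\sigma_{ik}\sigma_{jl},\ \underline{\sigma_{il}\sigma_{jk}}-\sigma_{ik}\sigma_{jl}\mid 1\le i<j<k<l\le|A|\}$$ (with leading terms of the tetrads underlined) is a reduced Gröbner basis for the ideal $I_{A,B,1}$ of the sparse one-factor analysis model with respect to any circular term order.
   Context: All polynomials live in $\mathbb{R}[\sigma_{ij},\ 1\le i<j\le p]$, with the convention $\sigma_{ij}=\sigma_{ji}$. $I_{A,B,1}$ is the ideal of invariants of the sparse one-factor analysis model with observed nodes $\{1,\dots,p\}$ and one latent node whose set of children is $A$ (the nodes in $B$ being isolated): it is the ideal of polynomials in $\mathbb{R}[\sigma_{ij},\ i<j]$ vanishing on the off-diagonal entries of all matrices $\Omega+\lambda\lambda^\top$, where $\Omega$ is diagonal with positive diagonal entries and $\lambda\in\mathbb{R}^p$ has $\lambda_i=0$ for $i\in B$. Equivalently it is the kernel of the ring homomorphism $\sigma_{ij}\mapsto t_it_j$ if $i,j\in A$ and $\sigma_{ij}\mapsto0$ otherwise (the toric ideal of the complete graph on $A$ together with isolated vertices $B$). Circular term order: place the vertices $1,\dots,p$ in this cyclic order as the $p$-th roots of unity. The edges $ij$ of the complete graph $K_p$ fall into $\lfloor p/2\rfloor$ classes (orbits of the dihedral group), determined by the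 cyclic distance $\min(|i-j|,p-|i-j|)$; classes with smaller cyclic distance are smaller. A circular term order is any block term order (the blocks of variables being the classes) such that $\sigma_{i_1j_1}\succ\sigma_{i_2j_2}$ whenever the edge $i_1j_1$ is in a smaller class than the edge $i_2j_2$. Thus monomials are compared first on the variables of the smallest class, then on the next class, and so on, using an arbitrary term order within each block. *)

theory Defs
  imports Complex_Main "HOL-Library.Poly_Mapping" "HOL-Algebra.Ideal"
begin

type_synonym 'x mon = "'x \<Rightarrow>\<^sub>0 nat"
type_synonym 'x rpoly = "'x mon \<Rightarrow>\<^sub>0 real"

text \<open>
  The type \<open>'x rpoly\<close> has one variable for every element of \<open>'x\<close>; the polynomial ring in a
  given set \<open>X\<close> of variables is a subring of it, taken as a ring in the sense of HOL-Algebra so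
  that ideals are ideals of that subring.
\<close>

definition monomials :: "'x set \<Rightarrow> 'x mon set" where
  "monomials X = {m. Poly_Mapping.keys m \<subseteq> X}"

definition poly_ring :: "'x set \<Rightarrow> 'x rpoly ring" where
  "poly_ring X = \<lparr>carrier = {f. Poly_Mapping.keys f \<subseteq> monomials X}, monoid.mult = (*), one = 1, zero = 0, add = (+)\<rparr>"

definition eval_poly :: "('x \<Rightarrow> real) \<Rightarrow> 'x rpoly \<Rightarrow> real" where
  "eval_poly v f = (\<Sum>m\<in>Poly_Mapping.keys f. Poly_Mapping.lookup f m * (\<Prod>x\<in>Poly_Mapping.keys m. v x ^ Poly_Mapping.lookup m x))"

subsection \<open>Term orders and Groebner bases\<close>

text \<open>\<open>(s, t) \<in> r\<close> means that \<open>s\<close> is at most \<open>t\<close>. Monomials are written additively, so \<open>0\<close> is the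
  monomial \<open>1\<close>.\<close>

definition term_order :: "'x set \<Rightarrow> 'x mon rel \<Rightarrow> bool" where
  "term_order X r \<longleftrightarrow> linear_order_on (monomials X) r \<and>
     (\<forall>m\<in>monomials X. (0, m) \<in> r) \<and>
     (\<forall>s t. \<forall>u\<in>monomials X. (s, t) \<in> r \<longrightarrow> (s + u, t + u) \<in> r)"

definition lead_mon :: "'x mon rel \<Rightarrow> 'x rpoly \<Rightarrow> 'x mon" where
  "lead_mon r f = (THE m. m \<in> Poly_Mapping.keys f \<and> (\<forall>m'\<in>Poly_Mapping.keys f. (m', m) \<in> r))"

text \<open>For \<open>f = 0\<close> the value of \<open>lead_mon\<close> is unspecified, but \<open>lead_term r 0 = 0\<close>.\<close>

definition lead_term :: "'x mon rel \<Rightarrow> 'x rpoly \<Rightarrow> 'x rpoly" where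
  "lead_term r f = Poly_Mapping.single (lead_mon r f) (Poly_Mapping.lookup f (lead_mon r f))"

definition groebner_basis :: "'x set \<Rightarrow> 'x mon rel \<Rightarrow> 'x rpoly set \<Rightarrow> 'x rpoly set \<Rightarrow> bool" where
  "groebner_basis X r G I \<longleftrightarrow> ideal I (poly_ring X) \<and> finite G \<and> G \<subseteq> I \<and>
     Idl\<^bsub>poly_ring X\<^esub> (lead_term r ` G) = Idl\<^bsub>poly_ring X\<^esub> (lead_term r ` I)"

definition reduced_groebner_basis ::
    "'x set \<Rightarrow> 'x mon rel \<Rightarrow> 'x rpoly set \<Rightarrow> 'x rpoly set \<Rightarrow> bool" where
  "reduced_groebner_basis X r G I \<longleftrightarrow> groebner_basis X r G I \<and>
     (\<forall>g\<in>G. g \<noteq> 0 \<and> Poly_Mapping.lookup g (lead_mon r g) = 1 \<and>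
        (\<forall>h\<in>G - {g}. \<forall>m\<in>Poly_Mapping.keys h. \<nexists>u. m = lead_mon r g + u))"

definition restrict_mon :: "'x set \<Rightarrow> 'x mon \<Rightarrow> 'x mon" where
  "restrict_mon X m = Poly_Mapping.mapp (\<lambda>x n. n when x \<in> X) m"

text \<open>The block order for blocks \<open>X 1, \<dots>, X n\<close>, compared in this sequence, where \<open>ords k\<close> compares
  monomials in the block \<open>X k\<close>.\<close>

definition block_order :: "nat \<Rightarrow> (nat \<Rightarrow> 'x set) \<Rightarrow> (nat \<Rightarrow> 'x mon rel) \<Rightarrow> 'x mon rel" where
  "block_order n X ords = {(s, t).
     s \<in> monomials (\<Union>k\<in>{1..n}. X k) \<and> t \<in> monomials (\<Union>k\<in>{1..n}. X k) \<and>
     (s = t \<or> (\<exists>k\<in>{1..n}.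
        (\<forall>l\<in>{1..<k}. restrict_mon (X l) s = restrict_mon (X l) t) \<and>
        restrict_mon (X k) s \<noteq> restrict_mon (X k) t \<and>
        (restrict_mon (X k) s, restrict_mon (X k) t) \<in> ords k))}"

subsection \<open>Edges of the complete graph and circular term orders\<close>

definition edges :: "nat set \<Rightarrow> (nat \<times> nat) set" where
  "edges V = {(i, j). i \<in> V \<and> j \<in> V \<and> i < j}"

definition sigma :: "nat \<Rightarrow> nat \<Rightarrow> (nat \<times> nat) rpoly" where
  "sigma i j = Poly_Mapping.single (Poly_Mapping.single (min i j, max i j) 1) 1"

definition edge_class :: "nat \<Rightarrow> nat \<Rightarrow> (nat \<times> nat) set" where
  "edge_class p d = {(i, j) \<in> edges {1..p}. min (j - i) (p - (j - i)) = d}"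

text \<open>As the classes are compared by increasing cyclic distance, every variable of a smaller class
  is larger than every variable of a larger class; see \<open>circular_term_order_sigma\<close> below.\<close>

definition circular_term_order :: "nat \<Rightarrow> (nat \<times> nat) mon rel \<Rightarrow> bool" where
  "circular_term_order p r \<longleftrightarrow>
     (\<exists>ords. (\<forall>d\<in>{1..p div 2}. term_order (edge_class p d) (ords d)) \<and>
        r = block_order (p div 2) (edge_class p) ords)"

subsection \<open>The sparse one-factor analysis model\<close>

text \<open>Only the entries with indices in \<open>A \<union> B\<close> of these covariance matrices are meaningful.\<close>

definition one_factor_model :: "nat set \<Rightarrow> nat set \<Rightarrow> (nat \<Rightarrow> nat \<Rightarrow> real) set" where
  "one_factor_model A B = {\<lambda>i j. \<Omega> i j + lam i * lam j | \<Omega> lam.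
     (\<forall>i\<in>A \<union> B. \<forall>j\<in>A \<union> B. i \<noteq> j \<longrightarrow> \<Omega> i j = 0) \<and>
     (\<forall>i\<in>A \<union> B. \<Omega> i i > 0) \<and>
     (\<forall>i\<in>B. lam i = 0)}"

definition one_factor_ideal :: "nat set \<Rightarrow> nat set \<Rightarrow> (nat \<times> nat) rpoly set" where
  "one_factor_ideal A B = {f \<in> carrier (poly_ring (edges (A \<union> B))).
     \<forall>S\<in>one_factor_model A B. eval_poly (\<lambda>(i, j). S i j) f = 0}"

subsection \<open>Circular term orders are term orders\<close>

lemma lookup_restrict_mon: "Poly_Mapping.lookup (restrict_mon X m) x = (Poly_Mapping.lookup m x when x \<in> X)"
  by (auto simp: restrict_mon_def lookup_mapp when_def in_keys_iff)

lemma restrict_mon_add: "restrict_mon X (s + t) = restrict_mon X s + restrict_mon X t"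
  by (rule poly_mapping_eqI) (simp add: lookup_restrict_mon lookup_add when_def)

lemma restrict_mon_0 [simp]: "restrict_mon X 0 = 0"
  by (rule poly_mapping_eqI) (simp add: lookup_restrict_mon)

lemma restrict_mon_in: "restrict_mon X m \<in> monomials X"
  by (auto simp: monomials_def in_keys_iff lookup_restrict_mon when_def split: if_splits)

lemma restrict_mon_eqI:
  assumes "s \<in> monomials (\<Union>k\<in>K. X k)" "t \<in> monomials (\<Union>k\<in>K. X k)"
    and "\<And>k. k \<in> K \<Longrightarrow> restrict_mon (X k) s = restrict_mon (X k) t"
  shows "s = t"
proof (rule poly_mapping_eqI)
  fix x
  show "Poly_Mapping.lookup s x = Poly_Mapping.lookup t x"
  proof (cases "x \<in> (\<Union>k\<in>K. X k)")
    case True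
    then obtain k where k: "k \<in> K" "x \<in> X k" by blast
    show ?thesis
      using arg_cong[OF assms(3)[OF k(1)], of "\<lambda>m. Poly_Mapping.lookup m x"] k(2)
      by (simp add: lookup_restrict_mon)
  next
    case False
    then have "x \<notin> Poly_Mapping.keys s" "x \<notin> Poly_Mapping.keys t" using assms(1,2) unfolding monomials_def by blast+
    then show ?thesis by (simp add: in_keys_iff)
  qed
qed

lemma monomials_add: "s \<in> monomials X \<Longrightarrow> t \<in> monomials X \<Longrightarrow> s + t \<in> monomials X"
  using Poly_Mapping.keys_add[of s t] unfolding monomials_def by blast

lemma first_difference:
  fixes n :: nat
  assumes "s \<in> monomials (\<Union>k\<in>{1..n}. X k)" "t \<in> monomials (\<Union>k\<in>{1..n}. X k)" "s \<noteq> t"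
  obtains k where "k \<in> {1..n}" "\<forall>l\<in>{1..<k}. restrict_mon (X l) s = restrict_mon (X l) t"
    "restrict_mon (X k) s \<noteq> restrict_mon (X k) t"
proof -
  define P where "P k \<longleftrightarrow> k \<in> {1..n} \<and> restrict_mon (X k) s \<noteq> restrict_mon (X k) t" for k
  obtain k0 where "P k0" using restrict_mon_eqI[OF assms(1,2)] assms(3) unfolding P_def by blast
  then have 1: "P (LEAST k. P k)" by (rule LeastI)
  show thesis
  proof (rule that)
    show "\<forall>l\<in>{1..<(LEAST k. P k)}. restrict_mon (X l) s = restrict_mon (X l) t"
    proof
      fix l assume l: "l \<in> {1..<(LEAST k. P k)}"
      then have "\<not> P l" by (intro not_less_Least) simp
      with l 1 show "restrict_mon (X l) s = restrict_mon (X l) t" unfolding P_def by auto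
    qed
  qed (use 1 in \<open>auto simp: P_def\<close>)
qed

lemma term_order_block_order:
  assumes to: "\<And>k. k \<in> {1..n} \<Longrightarrow> term_order (X k) (ords k)"
  shows "term_order (\<Union>k\<in>{1..n}. X k) (block_order n X ords)"
proof -
  let ?M = "monomials (\<Union>k\<in>{1..n}. X k)" and ?r = "block_order n X ords" and ?R = "\<lambda>k. restrict_mon (X k)"
  have lin: "linear_order_on (monomials (X k)) (ords k)" if "k \<in> {1..n}" for k
    using to[OF that] by (simp add: term_order_def)
  have strict: "(s, t) \<in> ?r" if "s \<in> ?M" "t \<in> ?M" "k \<in> {1..n}" "\<forall>l\<in>{1..<k}. ?R l s = ?R l t"
    "?R k s \<noteq> ?R k t" "(?R k s, ?R k t) \<in> ords k" for s t k
    using that unfolding block_order_def by blast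
  have cases: thesis if "(s, t) \<in> ?r" "s \<noteq> t"
    "\<And>k. k \<in> {1..n} \<Longrightarrow> \<forall>l\<in>{1..<k}. ?R l s = ?R l t \<Longrightarrow> ?R k s \<noteq> ?R k t \<Longrightarrow> (?R k s, ?R k t) \<in> ords k \<Longrightarrow> thesis"
    for s t thesis using that unfolding block_order_def by blast
  have sub: "?r \<subseteq> ?M \<times> ?M" unfolding block_order_def by blast
  have refl: "refl_on ?M ?r" unfolding refl_on_def block_order_def by blast
  have trans: "trans ?r"
  proof (rule transI)
    fix s t u assume st: "(s, t) \<in> ?r" and tu: "(t, u) \<in> ?r"
    have M: "s \<in> ?M" "t \<in> ?M" "u \<in> ?M" using st tu sub by blast+
    show "(s, u) \<in> ?r"
    proof (cases "s = t \<or> t = u")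
      case True then show ?thesis using st tu by blast
    next
      case False
      then have ne: "s \<noteq> t" "t \<noteq> u" by auto
      obtain k where k: "k \<in> {1..n}" "\<forall>l\<in>{1..<k}. ?R l s = ?R l t" "?R k s \<noteq> ?R k t" "(?R k s, ?R k t) \<in> ords k"
        by (rule cases[OF st ne(1)])
      obtain m where m: "m \<in> {1..n}" "\<forall>l\<in>{1..<m}. ?R l t = ?R l u" "?R m t \<noteq> ?R m u" "(?R m t, ?R m u) \<in> ords m"
        by (rule cases[OF tu ne(2)])
      consider "k < m" | "m < k" | "k = m" by linarith
      then show ?thesis
      proof cases
        case 1
        then have "?R k t = ?R k u" using m(2) k(1) by simp
        moreover have "\<forall>l\<in>{1..<k}. ?R l s = ?R l u" using 1 k(2) m(2) by simp
        ultimately show ?thesis using strict[OF M(1,3) k(1)] k(3,4) by simp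
      next
        case 2
        then have "?R m s = ?R m t" using k(2) m(1) by simp
        moreover have "\<forall>l\<in>{1..<m}. ?R l s = ?R l u" using 2 k(2) m(2) by simp
        ultimately show ?thesis using strict[OF M(1,3) m(1)] m(3,4) by simp
      next
        case 3
        have tr: "trans (ords k)" and as: "antisym (ords k)"
          using lin[OF k(1)] by (auto simp: order_on_defs)
        have "(?R k s, ?R k u) \<in> ords k" using tr k(4) m(4) 3 by (blast dest: transD)
        moreover have "?R k s \<noteq> ?R k u" using as k(3,4) m(4) 3 by (auto dest: antisymD)
        moreover have "\<forall>l\<in>{1..<k}. ?R l s = ?R l u" using 3 k(2) m(2) by simp
        ultimately show ?thesis using strict[OF M(1,3) k(1)] by simp
      qed
    qed
  qed
  have antisym: "antisym ?r"
  proof (rule antisymI, rule ccontr)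
    fix s t assume st: "(s, t) \<in> ?r" and ts: "(t, s) \<in> ?r" and ne: "s \<noteq> t"
    obtain k where k: "k \<in> {1..n}" "\<forall>l\<in>{1..<k}. ?R l s = ?R l t" "?R k s \<noteq> ?R k t" "(?R k s, ?R k t) \<in> ords k"
      by (rule cases[OF st ne])
    obtain m where m: "m \<in> {1..n}" "\<forall>l\<in>{1..<m}. ?R l t = ?R l s" "?R m t \<noteq> ?R m s" "(?R m t, ?R m s) \<in> ords m"
      by (rule cases[OF ts ne[symmetric]])
    have "\<not> k < m" "\<not> m < k" using k m by auto
    then have "k = m" by simp
    moreover have "antisym (ords k)" using lin[OF k(1)] by (auto simp: order_on_defs)
    ultimately show False using k(3,4) m(4) by (auto dest: antisymD)
  qed
  have total: "total_on ?M ?r"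
    unfolding total_on_def
  proof (intro ballI impI)
    fix s t assume M: "s \<in> ?M" "t \<in> ?M" and ne: "s \<noteq> t"
    obtain k where k: "k \<in> {1..n}" "\<forall>l\<in>{1..<k}. ?R l s = ?R l t" "?R k s \<noteq> ?R k t"
      by (rule first_difference[OF M ne])
    have "total_on (monomials (X k)) (ords k)" using lin[OF k(1)] by (simp add: order_on_defs)
    then have "(?R k s, ?R k t) \<in> ords k \<or> (?R k t, ?R k s) \<in> ords k"
      using k(3) restrict_mon_in unfolding total_on_def by blast
    then show "(s, t) \<in> ?r \<or> (t, s) \<in> ?r"
      using strict[OF M k(1,2,3)] strict[OF M(2,1) k(1)] k(2,3) by auto
  qed
  have zero: "(0, m) \<in> ?r" if m: "m \<in> ?M" for m
  proof (cases "m = 0")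
    case True then show ?thesis using refl m unfolding refl_on_def by blast
  next
    case False
    have M0: "0 \<in> ?M" by (simp add: monomials_def)
    obtain k where k: "k \<in> {1..n}" "\<forall>l\<in>{1..<k}. ?R l 0 = ?R l m" "?R k 0 \<noteq> ?R k m"
      by (rule first_difference[OF M0 m False[symmetric]])
    have "(?R k 0, ?R k m) \<in> ords k" using to[OF k(1)] restrict_mon_in[of "X k" m] by (simp add: term_order_def)
    then show ?thesis using strict[OF M0 m k] by blast
  qed
  have add: "(s + u, t + u) \<in> ?r" if u: "u \<in> ?M" and st: "(s, t) \<in> ?r" for s t u
  proof -
    have "s \<in> ?M" "t \<in> ?M" using st sub by blast+
    then have M: "s + u \<in> ?M" "t + u \<in> ?M" using u monomials_add by blast+
    show ?thesis
    proof (cases "s = t")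
      case True then show ?thesis using refl M unfolding refl_on_def by blast
    next
      case False
      obtain k where k: "k \<in> {1..n}" "\<forall>l\<in>{1..<k}. ?R l s = ?R l t" "?R k s \<noteq> ?R k t" "(?R k s, ?R k t) \<in> ords k"
        by (rule cases[OF st False])
      have "(?R k s + ?R k u, ?R k t + ?R k u) \<in> ords k"
        using to[OF k(1)] restrict_mon_in[of "X k" u] k(4) by (simp add: term_order_def)
      then show ?thesis using strict[OF M k(1)] k(2,3) by (simp add: restrict_mon_add)
    qed
  qed
  show ?thesis
    using sub refl trans antisym total zero add unfolding term_order_def order_on_defs by blast
qed

lemma Union_edge_class: "(\<Union>d\<in>{1..p div 2}. edge_class p d) = edges {1..p}"
  by (auto simp: edge_class_def edges_def)

lemma circular_term_order_is_term_order:
  assumes "circular_term_order p r"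
  shows "term_order (edges {1..p}) r"
  using assms term_order_block_order Union_edge_class unfolding circular_term_order_def by metis

lemma circular_term_order_sigma:
  assumes r: "circular_term_order p r"
    and e: "e \<in> edge_class p d" and e': "e' \<in> edge_class p d'" and "d < d'"
  shows "(Poly_Mapping.single e' 1, Poly_Mapping.single e 1) \<in> r \<and>
    Poly_Mapping.single e' 1 \<noteq> (Poly_Mapping.single e 1 :: (nat \<times> nat) mon)"
proof -
  let ?s = "Poly_Mapping.single e 1 :: (nat \<times> nat) mon" and ?t = "Poly_Mapping.single e' 1 :: (nat \<times> nat) mon"
  obtain ords where to: "\<And>d. d \<in> {1..p div 2} \<Longrightarrow> term_order (edge_class p d) (ords d)"
    and r_eq: "r = block_order (p div 2) (edge_class p) ords"
    using r unfolding circular_term_order_def by blast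
  have d: "d \<in> {1..p div 2}" using e by (auto simp: edge_class_def edges_def)
  have E: "e \<in> edges {1..p}" "e' \<in> edges {1..p}" using e e' by (auto simp: edge_class_def)
  have other: "restrict_mon (edge_class p l) (Poly_Mapping.single x 1) = 0"
    if "x \<in> edge_class p k" "l \<noteq> k" for l k x
    using that by (intro poly_mapping_eqI)
      (auto simp: lookup_restrict_mon lookup_single when_def edge_class_def)
  have own: "restrict_mon (edge_class p d) ?s = ?s"
    using e by (intro poly_mapping_eqI) (auto simp: lookup_restrict_mon lookup_single when_def)
  have "(0, ?s) \<in> ords d" using to[OF d] e by (simp add: term_order_def monomials_def)
  moreover have "?s \<noteq> 0" by (metis lookup_single_eq lookup_zero zero_neq_one)
  moreover have "restrict_mon (edge_class p d) ?t = 0" using other[OF e'] \<open>d < d'\<close> by simp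
  moreover have "\<forall>l\<in>{1..<d}. restrict_mon (edge_class p l) ?t = restrict_mon (edge_class p l) ?s"
    using other[OF e'] other[OF e] \<open>d < d'\<close> by simp
  moreover have "?s \<in> monomials (edges {1..p})" "?t \<in> monomials (edges {1..p})"
    using E by (auto simp: monomials_def)
  ultimately have "(?t, ?s) \<in> r"
    using d own unfolding r_eq block_order_def Union_edge_class by auto
  moreover have "?t \<noteq> ?s"
    using \<open>?s \<noteq> 0\<close> own \<open>restrict_mon (edge_class p d) ?t = 0\<close> by metis
  ultimately show ?thesis by blast
qed

end

theory Submission
  imports Defs "HOL-Computational_Algebra.Polynomial"
begin

text \<open>
  If a leading monomial of an element of the ideal involves only edges inside \<open>A\<close>, then some other
  monomial of that element has the same vertex degrees. Were it divisible by no leading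
  monomial of a tetrad, any two of its edges would cross or share a vertex (a thrackle). A thrackle is
  determined by its vertex degrees, and the smallest monomial with given vertex degrees is a thrackle.
  So the leading monomial would be smaller than the other monomial, a contradiction.
\<close>

subsection \<open>Evaluation and polynomial rings\<close>

text \<open>No S-polynomial is reduced: the basis property is checked directly, as divisibility of
  the leading monomial of every nonzero element of the ideal by the leading monomial of a generator.
  The vertex degrees of a monomial are its exponents after the substitution of
  \<open>t_i t_j\<close> for the variable of \<open>ij\<close>. As the ideal is defined by vanishing
  on covariance matrices and not as the kernel of this substitution, the second monomial of equal
  degrees comes from evaluation along a curve in the model, which turns vanishing into a statement
  on coefficients of a univariate polynomial. A monomial with an edge outside \<open>A\<close>
  evaluates to zero there, so it does not interfere, and it is a multiple of a degree-one generator
  anyway. Besides being a term order, a circular order enters only through one fact: a crossing pair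
  of edges is smaller than each of the two non-crossing pairs on the same four vertices.\<close>

definition eval_mon :: "('x \<Rightarrow> real) \<Rightarrow> 'x mon \<Rightarrow> real" where
  "eval_mon v m = (\<Prod>x\<in>Poly_Mapping.keys m. v x ^ Poly_Mapping.lookup m x)"

lemma eval_mon_superset:
  assumes "finite X" "m \<in> monomials X"
  shows "eval_mon v m = (\<Prod>x\<in>X. v x ^ Poly_Mapping.lookup m x)"
  unfolding eval_mon_def using assms
  by (intro prod.mono_neutral_left) (auto simp: monomials_def in_keys_iff)

lemma eval_mon_add: "eval_mon v (s + t) = eval_mon v s * eval_mon v t"
proof -
  let ?X = "Poly_Mapping.keys s \<union> Poly_Mapping.keys t"
  have "s \<in> monomials ?X" "t \<in> monomials ?X" by (auto simp: monomials_def)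
  then show ?thesis
    using monomials_add[of s ?X t]
    by (simp add: eval_mon_superset[of ?X] lookup_add power_add prod.distrib)
qed

lemma eval_mon_single [simp]: "eval_mon v (Poly_Mapping.single x n) = v x ^ n"
  by (simp add: eval_mon_def)

lemma eval_poly_superset:
  assumes "finite K" "Poly_Mapping.keys f \<subseteq> K"
  shows "eval_poly v f = (\<Sum>m\<in>K. Poly_Mapping.lookup f m * eval_mon v m)"
  unfolding eval_poly_def eval_mon_def[symmetric] using assms
  by (intro sum.mono_neutral_left) (auto simp: in_keys_iff)

lemma eval_poly_0 [simp]: "eval_poly v 0 = 0"
  by (simp add: eval_poly_def)

lemma eval_poly_single [simp]: "eval_poly v (Poly_Mapping.single m c) = c * eval_mon v m"
  by (simp add: eval_poly_def eval_mon_def)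

lemma eval_poly_add: "eval_poly v (f + g) = eval_poly v f + eval_poly v g"
proof -
  let ?K = "Poly_Mapping.keys f \<union> Poly_Mapping.keys g"
  show ?thesis
    using Poly_Mapping.keys_add[of f g]
    by (simp add: eval_poly_superset[of ?K] lookup_add ring_distribs sum.distrib)
qed

lemma eval_poly_diff: "eval_poly v (f - g) = eval_poly v f - eval_poly v g"
  using eval_poly_add[of v "f - g" g] by simp

lemma eval_poly_sum: "eval_poly v (sum f K) = (\<Sum>x\<in>K. eval_poly v (f x))"
  by (induction K rule: infinite_finite_induct) (simp_all add: eval_poly_add)

lemma sum_single_lookup: "(\<Sum>m\<in>Poly_Mapping.keys f. Poly_Mapping.single m (Poly_Mapping.lookup f m)) = f"
proof (rule poly_mapping_eqI)
  fix k
  show "Poly_Mapping.lookup (\<Sum>m\<in>Poly_Mapping.keys f. Poly_Mapping.single m (Poly_Mapping.lookup f m)) k = Poly_Mapping.lookup f k"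
    by (simp add: lookup_sum lookup_single when_def in_keys_iff)
qed

lemma eval_poly_mult: "eval_poly v (f * g) = eval_poly v f * eval_poly v g"
proof -
  let ?c = "\<lambda>f m. Poly_Mapping.single m (Poly_Mapping.lookup f m)"
  have "f * g = (\<Sum>m\<in>Poly_Mapping.keys f. ?c f m) * (\<Sum>m\<in>Poly_Mapping.keys g. ?c g m)"
    by (simp add: sum_single_lookup)
  also have "\<dots> = (\<Sum>m\<in>Poly_Mapping.keys f. \<Sum>n\<in>Poly_Mapping.keys g. ?c f m * ?c g n)"
    by (simp add: sum_product)
  finally have "eval_poly v (f * g) = (\<Sum>m\<in>Poly_Mapping.keys f. \<Sum>n\<in>Poly_Mapping.keys g.
      (Poly_Mapping.lookup f m * eval_mon v m) * (Poly_Mapping.lookup g n * eval_mon v n))"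
    by (simp add: eval_poly_sum mult_single eval_mon_add algebra_simps)
  then show ?thesis
    by (simp add: eval_poly_superset[OF finite_keys order_refl] sum_product)
qed

lemma carrier_poly_ring: "f \<in> carrier (poly_ring X) \<longleftrightarrow> Poly_Mapping.keys f \<subseteq> monomials X"
  by (simp add: poly_ring_def)

lemma poly_ring_simps [simp]:
  "x \<otimes>\<^bsub>poly_ring X\<^esub> y = x * y" "x \<oplus>\<^bsub>poly_ring X\<^esub> y = x + y"
  "\<one>\<^bsub>poly_ring X\<^esub> = 1" "\<zero>\<^bsub>poly_ring X\<^esub> = 0"
  by (simp_all add: poly_ring_def)

lemma cring_poly_ring: "cring (poly_ring X)"
proof (rule cringI)
  have mult: "x * y \<in> carrier (poly_ring X)"
    if "x \<in> carrier (poly_ring X)" "y \<in> carrier (poly_ring X)" for x y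
    using that Poly_Mapping.keys_mult[of x y] monomials_add unfolding carrier_poly_ring by blast
  have add: "x + y \<in> carrier (poly_ring X)"
    if "x \<in> carrier (poly_ring X)" "y \<in> carrier (poly_ring X)" for x y
    using that Poly_Mapping.keys_add[of x y] unfolding carrier_poly_ring by blast
  have minus: "- x \<in> carrier (poly_ring X)" if "x \<in> carrier (poly_ring X)" for x
    using that unfolding carrier_poly_ring by (auto simp: in_keys_iff)
  show "abelian_group (poly_ring X)"
  proof (rule abelian_groupI)
    show "\<exists>y\<in>carrier (poly_ring X). y \<oplus>\<^bsub>poly_ring X\<^esub> x = \<zero>\<^bsub>poly_ring X\<^esub>"
      if "x \<in> carrier (poly_ring X)" for x
      using minus[OF that] by (intro bexI[of _ "- x"]) simp_all
  qed (simp_all add: add algebra_simps, simp add: carrier_poly_ring)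
  show "comm_monoid (poly_ring X)"
    by (rule comm_monoidI) (simp_all add: mult algebra_simps, simp add: carrier_poly_ring monomials_def)
qed (simp add: algebra_simps)

lemma ideal_vanishing: "ideal {f \<in> carrier (poly_ring X). \<forall>v\<in>V. eval_poly v f = 0} (poly_ring X)"
  (is "ideal ?I _")
proof -
  let ?R = "poly_ring X"
  interpret cring ?R by (rule cring_poly_ring)
  have m: "x * f \<in> ?I" if "f \<in> ?I" "x \<in> carrier ?R" for x f
    using that m_closed[of x f] by (simp add: eval_poly_mult)
  have a: "f + g \<in> ?I" if "f \<in> ?I" "g \<in> ?I" for f g
    using that a_closed[of f g] by (simp add: eval_poly_add)
  show ?thesis
  proof (rule idealI)
    show "subgroup ?I (add_monoid ?R)"
    proof
      show "inv\<^bsub>add_monoid ?R\<^esub> f \<in> ?I" if f: "f \<in> ?I" for f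
      \<comment> \<open>The additive inverse of the ring record is abstract, so it is rewritten as
        minus one times \<open>f\<close>; closure under multiplication by ring elements then
        suffices.\<close>
      proof -
        have "\<ominus>\<^bsub>?R\<^esub> f = (\<ominus>\<^bsub>?R\<^esub> \<one>\<^bsub>?R\<^esub>) * f"
          using f l_minus[OF one_closed, of f] l_one[of f] by (simp del: l_minus l_one)
        moreover have "(\<ominus>\<^bsub>?R\<^esub> \<one>\<^bsub>?R\<^esub>) * f \<in> ?I"
          by (rule m[OF f a_inv_closed[OF one_closed]])
        ultimately show ?thesis by (simp only: a_inv_def)
      qed
    qed (use a zero_closed in auto)
    show "x \<otimes>\<^bsub>?R\<^esub> f \<in> ?I" "f \<otimes>\<^bsub>?R\<^esub> x \<in> ?I" if "f \<in> ?I" "x \<in> carrier ?R" for f x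
      using m[OF that] by (simp_all add: mult.commute)
  qed (rule ring_axioms)
qed

subsection \<open>Leading terms\<close>

text \<open>Used for \<open>r\<close>, where it yields leading monomials, and for the converse of
  \<open>r\<close>, where it yields the smallest monomial of a fiber.\<close>

lemma linear_order_finite_greatest:
  assumes "linear_order_on A r" "finite S" "S \<noteq> {}" "S \<subseteq> A"
  shows "\<exists>m\<in>S. \<forall>m'\<in>S. (m', m) \<in> r"
  using assms(2,3,4)
proof (induction rule: finite_ne_induct)
  case (singleton x)
  then show ?case using assms(1) by (auto simp: order_on_defs refl_on_def)
next
  case (insert x F)
  then obtain m where m: "m \<in> F" "\<forall>m'\<in>F. (m', m) \<in> r" by auto
  have refl: "(x, x) \<in> r" and tr: "trans r" and tot: "total_on A r"
    using assms(1) insert.prems by (auto simp: order_on_defs refl_on_def)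
  show ?case
  proof (cases "(x, m) \<in> r")
    case True then show ?thesis using m by blast
  next
    case False
    have "x \<in> A" "m \<in> A" "x \<noteq> m" using insert.prems insert.hyps m(1) by auto
    then have "(m, x) \<in> r" using tot False by (auto simp: total_on_def)
    then have "\<forall>m'\<in>insert x F. (m', x) \<in> r" using m(2) refl tr by (auto dest: transD)
    then show ?thesis by blast
  qed
qed

lemma lead_mon_eqI:
  assumes "antisym r" "m \<in> Poly_Mapping.keys f" "\<And>m'. m' \<in> Poly_Mapping.keys f \<Longrightarrow> (m', m) \<in> r"
  shows "lead_mon r f = m"
  unfolding lead_mon_def using assms by (intro the_equality) (auto dest: antisymD)

lemma lead_mon_greatest:
  assumes "term_order X r" "f \<noteq> 0" "f \<in> carrier (poly_ring X)"
  shows "lead_mon r f \<in> Poly_Mapping.keys f"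
    and "m' \<in> Poly_Mapping.keys f \<Longrightarrow> (m', lead_mon r f) \<in> r"
proof -
  have lin: "linear_order_on (monomials X) r" using assms(1) by (simp add: term_order_def)
  obtain m where m: "m \<in> Poly_Mapping.keys f" "\<forall>m'\<in>Poly_Mapping.keys f. (m', m) \<in> r"
    using linear_order_finite_greatest[OF lin, of "Poly_Mapping.keys f"] assms(2,3)
    by (auto simp: carrier_poly_ring)
  then have "lead_mon r f = m"
    using lin by (intro lead_mon_eqI) (auto simp: order_on_defs)
  then show "lead_mon r f \<in> Poly_Mapping.keys f"
    "m' \<in> Poly_Mapping.keys f \<Longrightarrow> (m', lead_mon r f) \<in> r" using m by auto
qed

text \<open>With monic generators, divisibility of leading monomials lifts to leading terms: the
  cofactor is a single term carrying the leading coefficient of \<open>f\<close>.\<close>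

lemma groebner_basisI:
  assumes to: "term_order X r" and I: "ideal I (poly_ring X)" and G: "finite G" "G \<subseteq> I"
    and monic: "\<And>g. g \<in> G \<Longrightarrow> Poly_Mapping.lookup g (lead_mon r g) = 1"
    and div: "\<And>f. f \<in> I \<Longrightarrow> f \<noteq> 0 \<Longrightarrow> \<exists>g\<in>G. \<exists>u. lead_mon r f = lead_mon r g + u"
  shows "groebner_basis X r G I"
proof -
  let ?R = "poly_ring X"
  interpret cring ?R by (rule cring_poly_ring)
  have I_carrier: "I \<subseteq> carrier ?R"
    using I by (simp add: additive_subgroup.a_subset ideal.axioms(1))
  have lead_mon_in: "lead_mon r f \<in> monomials X" if "f \<in> I" "f \<noteq> 0" for f
    using lead_mon_greatest(1)[OF to] that I_carrier carrier_poly_ring by blast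
  have lead_0: "lead_term r 0 = 0" by (simp add: lead_term_def)
  have lead_in: "lead_term r f \<in> carrier ?R" if "f \<in> I" for f
    using lead_mon_in[OF that] lead_0 by (cases "f = 0") (auto simp: lead_term_def carrier_poly_ring)
  have idl: "ideal (Idl\<^bsub>?R\<^esub> (lead_term r ` G)) ?R"
    using lead_in G(2) by (intro genideal_ideal) blast
  have idl_I: "ideal (Idl\<^bsub>?R\<^esub> (lead_term r ` I)) ?R"
    using lead_in by (intro genideal_ideal) blast
  have "lead_term r f \<in> Idl\<^bsub>?R\<^esub> (lead_term r ` G)" if f: "f \<in> I" for f
  proof (cases "f = 0")
    case True
    then show ?thesis
      using lead_0 additive_subgroup.zero_closed[OF ideal.axioms(1)[OF idl]] by simp
  next
    case False
    obtain g u where g: "g \<in> G" and u: "lead_mon r f = lead_mon r g + u" using div[OF f False] by blast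
    \<comment> \<open>Exponents are natural numbers, so nothing cancels in the sum: the cofactor
      uses only variables from \<open>X\<close>, and the multiplier lies in the subring.\<close>
    have "Poly_Mapping.keys u \<subseteq> Poly_Mapping.keys (lead_mon r f)"
      by (auto simp: u in_keys_iff lookup_add)
    then have "u \<in> monomials X" using lead_mon_in[OF f False] unfolding monomials_def by blast
    then have "Poly_Mapping.single u (Poly_Mapping.lookup f (lead_mon r f)) \<in> carrier ?R"
      by (simp add: carrier_poly_ring)
    moreover have "lead_term r g \<in> Idl\<^bsub>?R\<^esub> (lead_term r ` G)"
      using genideal_self lead_in G(2) g by blast
    moreover have "lead_term r f = lead_term r g * Poly_Mapping.single u (Poly_Mapping.lookup f (lead_mon r f))"
      by (simp add: lead_term_def monic[OF g] mult_single flip: u)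
    ultimately show ?thesis using ideal.I_r_closed[OF idl] by fastforce
  qed
  then have "Idl\<^bsub>?R\<^esub> (lead_term r ` I) \<subseteq> Idl\<^bsub>?R\<^esub> (lead_term r ` G)"
    by (intro genideal_minimal[OF idl]) blast
  moreover have "Idl\<^bsub>?R\<^esub> (lead_term r ` G) \<subseteq> Idl\<^bsub>?R\<^esub> (lead_term r ` I)"
    using genideal_self[of "lead_term r ` I"] lead_in G(2) by (intro genideal_minimal[OF idl_I]) blast
  ultimately show ?thesis using I G by (simp add: groebner_basis_def)
qed

lemma reduced_groebner_basisI:
  assumes "groebner_basis X r G I" "\<And>g. g \<in> G \<Longrightarrow> Poly_Mapping.lookup g (lead_mon r g) = 1"
    and "\<And>g h m u. g \<in> G \<Longrightarrow> h \<in> G \<Longrightarrow> h \<noteq> g \<Longrightarrow> m \<in> Poly_Mapping.keys h \<Longrightarrow> m \<noteq> lead_mon r g + u"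
  shows "reduced_groebner_basis X r G I"
proof -
  have "g \<noteq> 0" if "g \<in> G" for g using assms(2)[OF that] by auto
  moreover have "\<nexists>u. m = lead_mon r g + u" if "g \<in> G" "h \<in> G - {g}" "m \<in> Poly_Mapping.keys h" for g h m
    using assms(3)[of g h m] that by auto
  ultimately show ?thesis using assms(1,2) unfolding reduced_groebner_basis_def by blast
qed

subsection \<open>Degree vectors determine thrackles\<close>

text \<open>The degree in the multigraph with edge multiplicities \<open>f\<close>. It is stated for
  functions, so that monomials enter through \<open>lookup\<close>; a loop would count
  twice.\<close>

definition vertex_degree :: "('v \<times> 'v) set \<Rightarrow> ('v \<times> 'v \<Rightarrow> nat) \<Rightarrow> 'v \<Rightarrow> nat" where
  "vertex_degree E f v = (\<Sum>e\<in>E. f e * (of_bool (fst e = v) + of_bool (snd e = v)))"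

text \<open>A weighted handshake count. An indicator of an initial segment as \<open>h\<close> gives
  partial sums of degrees; powers of a base \<open>N\<close> give the number whose digits are the
  degrees.\<close>

lemma sum_vertex_degree:
  fixes h :: "'v \<Rightarrow> nat"
  assumes "finite V" "E \<subseteq> V \<times> V"
  shows "(\<Sum>v\<in>V. vertex_degree E f v * h v) = (\<Sum>e\<in>E. f e * (h (fst e) + h (snd e)))"
proof -
  have "(\<Sum>v\<in>V. vertex_degree E f v * h v) =
      (\<Sum>e\<in>E. \<Sum>v\<in>V. f e * (of_bool (fst e = v) + of_bool (snd e = v)) * h v)"
    unfolding vertex_degree_def sum_distrib_right by (rule sum.swap)
  also have "\<dots> = (\<Sum>e\<in>E. f e * (h (fst e) + h (snd e)))"
  proof (rule sum.cong[OF refl])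
    fix e assume "e \<in> E"
    then have e: "fst e \<in> V" "snd e \<in> V" using assms(2) by auto
    have "(\<Sum>v\<in>V. f e * (of_bool (fst e = v) + of_bool (snd e = v)) * h v) =
        f e * ((\<Sum>v\<in>V. of_bool (fst e = v) * h v) + (\<Sum>v\<in>V. of_bool (snd e = v) * h v))"
      by (simp add: sum_distrib_left sum.distrib algebra_simps)
    also have "\<dots> = f e * (h (fst e) + h (snd e))"
      using e assms(1) by (simp add: of_bool_def if_distrib[of "\<lambda>x. x * _"] cong: if_cong)
    finally show "(\<Sum>v\<in>V. f e * (of_bool (fst e = v) + of_bool (snd e = v)) * h v) =
        f e * (h (fst e) + h (snd e))" .
  qed
  finally show ?thesis .
qed

text \<open>A two-dimensional cumulative count, chosen because for a thrackle it is a minimum of two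
  quantities read off from the degrees.\<close>

definition edge_count :: "(nat \<times> nat \<Rightarrow> nat) \<Rightarrow> nat \<Rightarrow> nat \<Rightarrow> nat" where
  "edge_count f x y = (\<Sum>i\<le>x. \<Sum>j\<le>y. f (i, j))"

text \<open>Differences in \<open>x\<close> recover the partial sums of each row, and differences in
  \<open>y\<close> then recover the entries.\<close>

lemma edge_count_inject:
  assumes eq: "\<And>x y. edge_count f x y = edge_count g x y"
  shows "f = g"
proof -
  have rows: "(\<Sum>j\<le>y. f (x, j)) = (\<Sum>j\<le>y. g (x, j))" for x y
  proof (cases x)
    case 0 then show ?thesis using eq[of 0 y] by (simp add: edge_count_def)
  next
    case (Suc z)
    then show ?thesis using eq[of z y] eq[of x y] by (simp add: edge_count_def)
  qed
  have "f (x, y) = g (x, y)" for x y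
  proof (cases y)
    case 0 then show ?thesis using rows[of x 0] by simp
  next
    case (Suc z)
    then show ?thesis using rows[of x z] rows[of x y] by simp
  qed
  then show ?thesis by auto
qed

text \<open>Two edges of a complete graph on cyclically ordered vertices cross or share a vertex unless
  they are disjoint intervals or strictly nested.\<close>

definition thrackle :: "(nat \<times> nat \<Rightarrow> nat) \<Rightarrow> bool" where
  "thrackle f \<longleftrightarrow> (\<forall>i j k l. f (i, j) \<noteq> 0 \<longrightarrow> f (k, l) \<noteq> 0 \<longrightarrow> k \<le> j \<and> \<not> (i < k \<and> l < j))"

text \<open>In a thrackle with \<open>n\<close> edges the lower ends are the \<open>n\<close> smallest among the \<open>2 n\<close> ends and
  the \<open>i\<close>-th lower end is joined to the \<open>i\<close>-th upper end.\<close>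

lemma edge_count_thrackle:
  assumes th: "thrackle f" and supp: "\<And>i j. f (i, j) \<noteq> 0 \<Longrightarrow> i \<le> p \<and> j \<le> p"
  defines "S \<equiv> \<lambda>v. \<Sum>w\<le>v. vertex_degree ({..p} \<times> {..p}) f w"
  defines "L \<equiv> \<lambda>v. min (S p div 2) (S v)"
  assumes x: "x \<le> p" and y: "y \<le> p"
  shows "edge_count f x y = min (L x) (S y - L y)"
proof -
  let ?E = "{..p} \<times> {..p}"
  have fin: "finite (?E :: (nat \<times> nat) set)" by simp
  define c where "c P = sum f {e \<in> ?E. P e}" for P
  have c_mono: "c P \<le> c Q" if "\<And>e. f e \<noteq> 0 \<Longrightarrow> P e \<Longrightarrow> Q e" for P Q
  proof -
    have "c P = sum f {e \<in> ?E. P e \<and> f e \<noteq> 0}"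
      unfolding c_def by (rule sum.mono_neutral_right) auto
    also have "\<dots> \<le> c Q"
      unfolding c_def using that by (intro sum_mono2) auto
    finally show ?thesis .
  qed
  have c_0: "c P = 0" if "\<And>e. f e \<noteq> 0 \<Longrightarrow> \<not> P e" for P
    using c_mono[of P "\<lambda>e. False"] that by (simp add: c_def)
  define n where "n = c (\<lambda>e. True)"
  \<comment> \<open>\<open>S v\<close> counts the edge ends at vertices up to \<open>v\<close>,
    lower and upper ends together. The next two steps show how a thrackle lets them be told
    apart.\<close>
  have S: "S v = c (\<lambda>e. fst e \<le> v) + c (\<lambda>e. snd e \<le> v)" if "v \<le> p" for v
  proof -
    have "S v = (\<Sum>w\<le>p. vertex_degree ?E f w * of_bool (w \<le> v))"
      unfolding S_def using that by (intro sum.mono_neutral_cong_left) auto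
    also have "\<dots> = (\<Sum>e\<in>?E. f e * (of_bool (fst e \<le> v) + of_bool (snd e \<le> v)))"
      by (rule sum_vertex_degree) auto
    also have "\<dots> = (\<Sum>e\<in>?E. f e * of_bool (fst e \<le> v)) + (\<Sum>e\<in>?E. f e * of_bool (snd e \<le> v))"
      by (simp add: sum.distrib distrib_left)
    also have "\<dots> = c (\<lambda>e. fst e \<le> v) + c (\<lambda>e. snd e \<le> v)"
      unfolding c_def sum.inter_filter[OF fin] by (simp add: of_bool_def if_distrib cong: if_cong)
    finally show ?thesis .
  qed
  have n: "S p div 2 = n"
  proof -
    have "c (\<lambda>e. fst e \<le> p) = n" "c (\<lambda>e. snd e \<le> p) = n"
      unfolding n_def c_def by (auto intro!: sum.cong)
    then show ?thesis using S[of p] by simp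
  qed
  \<comment> \<open>If some upper end is at most \<open>v\<close>, the thrackle condition puts every
    lower end below it, so all \<open>n\<close> lower ends are counted. Otherwise only lower ends
    are counted in \<open>S v\<close>.\<close>
  have low: "c (\<lambda>e. fst e \<le> v) = L v" if v: "v \<le> p" for v
  proof (cases "\<exists>i j. f (i, j) \<noteq> 0 \<and> j \<le> v")
    case True
    then obtain i j where ij: "f (i, j) \<noteq> 0" "j \<le> v" by blast
    have "k \<le> v" if "f (k, l) \<noteq> 0" for k l
      using th ij that unfolding thrackle_def by (meson order_trans)
    then have "n \<le> c (\<lambda>e. fst e \<le> v)" unfolding n_def by (intro c_mono) force
    moreover have "c (\<lambda>e. fst e \<le> v) \<le> n" unfolding n_def by (rule c_mono) simp
    ultimately show ?thesis using S[OF v] n by (simp add: L_def)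
  next
    case False
    then have "c (\<lambda>e. snd e \<le> v) = 0" by (intro c_0) (metis prod.collapse)
    moreover have "c (\<lambda>e. fst e \<le> v) \<le> n" unfolding n_def by (rule c_mono) simp
    ultimately show ?thesis using S[OF v] n by (simp add: L_def)
  qed
  have high: "c (\<lambda>e. snd e \<le> v) = S v - L v" if v: "v \<le> p" for v
    using S[OF v] low[OF v] by simp
  have "edge_count f x y = c (\<lambda>e. fst e \<le> x \<and> snd e \<le> y)"
  proof -
    have "{e \<in> ?E. fst e \<le> x \<and> snd e \<le> y} = {..x} \<times> {..y}" using x y by auto
    then show ?thesis unfolding edge_count_def c_def by (simp add: sum.cartesian_product)
  qed
  \<comment> \<open>The edges with lower end at most \<open>x\<close> and those with upper end at
    most \<open>y\<close> form nested sets: an edge only in the first set would strictly contain any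
    edge only in the second. Hence the intersection is the smaller of the two.\<close>
  also have "\<dots> = min (c (\<lambda>e. fst e \<le> x)) (c (\<lambda>e. snd e \<le> y))"
  proof (cases "\<exists>i j. f (i, j) \<noteq> 0 \<and> i \<le> x \<and> y < j")
    case True
    then obtain i j where ij: "f (i, j) \<noteq> 0" "i \<le> x" "y < j" by blast
    have "k \<le> x" if "f (k, l) \<noteq> 0" "l \<le> y" for k l
      using th ij that unfolding thrackle_def by (meson le_less_trans not_le)
    then have "c (\<lambda>e. snd e \<le> y) \<le> c (\<lambda>e. fst e \<le> x \<and> snd e \<le> y)"
      by (intro c_mono) (metis prod.collapse not_le)
    moreover have "c (\<lambda>e. fst e \<le> x \<and> snd e \<le> y) \<le> c (\<lambda>e. fst e \<le> x)"
      "c (\<lambda>e. fst e \<le> x \<and> snd e \<le> y) \<le> c (\<lambda>e. snd e \<le> y)" by (rule c_mono; simp)+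
    ultimately show ?thesis by simp
  next
    case False
    then have "c (\<lambda>e. fst e \<le> x) \<le> c (\<lambda>e. fst e \<le> x \<and> snd e \<le> y)"
      by (intro c_mono) (metis prod.collapse not_le)
    moreover have "c (\<lambda>e. fst e \<le> x \<and> snd e \<le> y) \<le> c (\<lambda>e. fst e \<le> x)"
      "c (\<lambda>e. fst e \<le> x \<and> snd e \<le> y) \<le> c (\<lambda>e. snd e \<le> y)" by (rule c_mono; simp)+
    ultimately show ?thesis by simp
  qed
  also have "\<dots> = min (L x) (S y - L y)" using low[OF x] high[OF y] by simp
  finally show ?thesis .
qed

text \<open>The formula of \<open>edge_count_thrackle\<close> mentions the thrackle only through its
  degrees.\<close>

lemma thrackle_unique:
  assumes "thrackle f" "thrackle g"
    and supp: "\<And>i j. f (i, j) \<noteq> 0 \<Longrightarrow> i \<le> p \<and> j \<le> p" "\<And>i j. g (i, j) \<noteq> 0 \<Longrightarrow> i \<le> p \<and> j \<le> p"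
    and deg: "vertex_degree ({..p} \<times> {..p}) f = vertex_degree ({..p} \<times> {..p}) g"
  shows "f = g"
proof (rule edge_count_inject)
  fix x y
  \<comment> \<open>The formula is available only up to \<open>p\<close>; beyond \<open>p\<close>
    there are no edges, so the counts are constant there.\<close>
  have trunc: "edge_count h x y = edge_count h (min x p) (min y p)"
    if "\<forall>i j. h (i, j) \<noteq> 0 \<longrightarrow> i \<le> p \<and> j \<le> p" for h
    unfolding edge_count_def sum.cartesian_product
    using that by (intro sum.mono_neutral_right) auto
  have "edge_count f (min x p) (min y p) = edge_count g (min x p) (min y p)"
    using deg by (simp add: edge_count_thrackle[OF assms(1) supp(1)] edge_count_thrackle[OF assms(2) supp(2)])
  then show "edge_count f x y = edge_count g x y"
    using trunc[of f] trunc[of g] supp by metis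
qed

subsection \<open>Separating degree vectors by powers of a single variable\<close>

lemma digit_sum_less:
  fixes N :: nat
  assumes "\<And>i. i < n \<Longrightarrow> a i < N"
  shows "(\<Sum>i<n. a i * N ^ i) < N ^ n"
  using assms
proof (induction n)
  case (Suc n)
  then have "(\<Sum>i<n. a i * N ^ i) < N ^ n" "Suc (a n) * N ^ n \<le> N * N ^ n"
    by (simp, intro mult_right_mono) (simp_all add: Suc_leI)
  then show ?case by simp
qed simp

text \<open>The lower digits sum to less than \<open>N ^ n\<close>, so division by
  \<open>N ^ n\<close> isolates the top digit.\<close>

lemma digit_sum_inject:
  fixes N :: nat
  assumes "\<And>i. i < n \<Longrightarrow> a i < N" "\<And>i. i < n \<Longrightarrow> b i < N"
    and "(\<Sum>i<n. a i * N ^ i) = (\<Sum>i<n. b i * N ^ i)" and "i < n"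
  shows "a i = b i"
  using assms
proof (induction n)
  case (Suc n)
  let ?s = "\<lambda>a. \<Sum>i<n. a i * N ^ i"
  have less: "?s a < N ^ n" "?s b < N ^ n"
    using digit_sum_less[of n a N] digit_sum_less[of n b N] Suc.prems(1,2) by simp_all
  have eq: "?s a + a n * N ^ n = ?s b + b n * N ^ n" using Suc.prems(3) by simp
  have "(x + c * N ^ n) div N ^ n = c" if "x < N ^ n" for x c
    using that by (cases "N ^ n = 0") simp_all
  then have "a n = (?s a + a n * N ^ n) div N ^ n" "b n = (?s b + b n * N ^ n) div N ^ n"
    using less by simp_all
  then have n: "a n = b n" using eq by simp
  then have "?s a = ?s b" using eq by simp
  then show ?case using Suc.IH Suc.prems(1,2,4) n by (cases "i = n") (simp_all add: less_Suc_eq)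
qed simp

text \<open>A real polynomial that vanishes everywhere has zero coefficients, and the coefficient of
  \<open>x ^ k\<close> collects exactly the indices of weight \<open>k\<close>.\<close>

lemma sum_power_coeff_eq_0:
  fixes c :: "'m \<Rightarrow> real"
  assumes "finite K" and "\<And>x. (\<Sum>m\<in>K. c m * x ^ w m) = 0"
  shows "(\<Sum>m | m \<in> K \<and> w m = k. c m) = 0"
proof -
  let ?P = "\<Sum>m\<in>K. monom (c m) (w m)"
  have "poly ?P x = 0" for x using assms(2)[of x] by (simp add: poly_sum poly_monom)
  then have "coeff ?P k = 0" using poly_all_0_iff_0 by (metis coeff_0)
  then show ?thesis
    using assms(1) by (simp add: coeff_sum sum.inter_filter)
qed

subsection \<open>Tetrads\<close>

text \<open>The pair is taken as given, whereas \<open>sigma\<close> sorts it first; the two agree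
  when \<open>i < j\<close>.\<close>

definition edge_mon :: "nat \<Rightarrow> nat \<Rightarrow> (nat \<times> nat) mon" where
  "edge_mon i j = Poly_Mapping.single (i, j) 1"

text \<open>Pairs of the leading and the trailing monomial.\<close>

inductive_set tetrad_terms :: "nat \<Rightarrow> ((nat \<times> nat) mon \<times> (nat \<times> nat) mon) set" for n where
  disjoint: "1 \<le> i \<Longrightarrow> i < j \<Longrightarrow> j < k \<Longrightarrow> k < l \<Longrightarrow> l \<le> n \<Longrightarrow>
    (edge_mon i j + edge_mon k l, edge_mon i k + edge_mon j l) \<in> tetrad_terms n"
| nested: "1 \<le> i \<Longrightarrow> i < j \<Longrightarrow> j < k \<Longrightarrow> k < l \<Longrightarrow> l \<le> n \<Longrightarrow>
    (edge_mon i l + edge_mon j k, edge_mon i k + edge_mon j l) \<in> tetrad_terms n"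

definition monomial_diff :: "'x mon \<Rightarrow> 'x mon \<Rightarrow> 'x rpoly" where
  "monomial_diff s t = Poly_Mapping.single s 1 - Poly_Mapping.single t 1"

lemma keys_edge_mon_add: "Poly_Mapping.keys (edge_mon i j + edge_mon k l) = {(i, j), (k, l)}"
  by (auto simp: edge_mon_def in_keys_iff lookup_add lookup_single when_def split: if_splits)

lemma sigma_mult_sigma:
  assumes "i < j" "k < l"
  shows "sigma i j * sigma k l = Poly_Mapping.single (edge_mon i j + edge_mon k l) 1"
  using assms by (simp add: sigma_def edge_mon_def mult_single min_def max_def)

lemma tetrads_eq:
  "(\<Union>(i, j, k, l) \<in> {(i, j, k, l). 1 \<le> i \<and> i < j \<and> j < k \<and> k < l \<and> l \<le> n}.
      {sigma i j * sigma k l - sigma i k * sigma j l, sigma i l * sigma j k - sigma i k * sigma j l}) =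
    (\<lambda>(s, t). monomial_diff s t) ` tetrad_terms n" (is "?L = ?R")
proof
  show "?L \<subseteq> ?R"
  proof (clarify)
    fix g i j k l assume *: "1 \<le> i" "i < j" "j < k" "k < l" "l \<le> n"
      and g: "g \<in> {sigma i j * sigma k l - sigma i k * sigma j l, sigma i l * sigma j k - sigma i k * sigma j l}"
    have "i < k" "j < l" "i < l" using * by auto
    then have "g = monomial_diff (edge_mon i j + edge_mon k l) (edge_mon i k + edge_mon j l) \<or>
        g = monomial_diff (edge_mon i l + edge_mon j k) (edge_mon i k + edge_mon j l)"
      using g * by (auto simp: sigma_mult_sigma monomial_diff_def)
    then show "g \<in> ?R" using disjoint[OF *] nested[OF *] by force
  qed
  show "?R \<subseteq> ?L"
  proof (clarify)
    fix s t assume "(s, t) \<in> tetrad_terms n"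
    then show "monomial_diff s t \<in> ?L"
    proof cases
      case (disjoint i j k l)
      then show ?thesis
        by (intro UN_I[of "(i, j, k, l)"]) (simp_all add: sigma_mult_sigma monomial_diff_def)
    next
      case (nested i j k l)
      then show ?thesis
        by (intro UN_I[of "(i, j, k, l)"]) (simp_all add: sigma_mult_sigma monomial_diff_def)
    qed
  qed
qed

lemma tetrad_terms_keysE:
  assumes "(s, t) \<in> tetrad_terms n"
  obtains i j k l where "1 \<le> i" "i < j" "j < k" "k < l" "l \<le> n"
    "Poly_Mapping.keys s = {(i, j), (k, l)} \<or> Poly_Mapping.keys s = {(i, l), (j, k)}"
    "Poly_Mapping.keys t = {(i, k), (j, l)}"
  using assms
proof cases
  case (disjoint i j k l)
  show thesis by (rule that[OF disjoint(3-)]) (simp_all only: disjoint(1,2) keys_edge_mon_add simp_thms)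
next
  case (nested i j k l)
  show thesis by (rule that[OF nested(3-)]) (simp_all only: nested(1,2) keys_edge_mon_add simp_thms)
qed

lemma tetrad_terms_monomials:
  assumes "(s, t) \<in> tetrad_terms n"
  shows "s \<in> monomials (edges {1..n})" "t \<in> monomials (edges {1..n})"
proof -
  obtain i j k l where *: "1 \<le> i" "i < j" "j < k" "k < l" "l \<le> n"
    and keys: "Poly_Mapping.keys s = {(i, j), (k, l)} \<or> Poly_Mapping.keys s = {(i, l), (j, k)}"
      "Poly_Mapping.keys t = {(i, k), (j, l)}"
    by (rule tetrad_terms_keysE[OF assms])
  show "s \<in> monomials (edges {1..n})" "t \<in> monomials (edges {1..n})"
    using * keys by (auto simp: monomials_def edges_def)
qed

text \<open>A leading monomial is a pair of non-crossing edges, a trailing one a pair of crossing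
  edges. Two possibly different tetrads are allowed because reducedness compares generators with one
  another.\<close>

lemma tetrad_lead_ne_trail:
  assumes "(s, t) \<in> tetrad_terms n" "(s', t') \<in> tetrad_terms n"
  shows "s \<noteq> t'"
proof
  assume "s = t'"
  obtain i j k l where *: "i < j" "j < k" "k < l"
    and s: "Poly_Mapping.keys s = {(i, j), (k, l)} \<or> Poly_Mapping.keys s = {(i, l), (j, k)}"
    by (rule tetrad_terms_keysE[OF assms(1)])
  obtain i' j' k' l' where ord': "i' < j'" "j' < k'" "k' < l'"
    and t': "Poly_Mapping.keys t' = {(i', k'), (j', l')}"
    by (rule tetrad_terms_keysE[OF assms(2)])
  show False using s t' * ord' \<open>s = t'\<close> by (auto simp: doubleton_eq_iff)
qed

text \<open>The support of the leading monomial gives the four vertices, and their sorted order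
  gives the crossing pair. Hence distinct tetrads have distinct leading monomials.\<close>

lemma tetrad_lead_inject:
  assumes "(s, t) \<in> tetrad_terms n" "(s, t') \<in> tetrad_terms n"
  shows "t = t'"
proof -
  obtain i j k l where *: "i < j" "j < k" "k < l"
    and s: "Poly_Mapping.keys s = {(i, j), (k, l)} \<or> Poly_Mapping.keys s = {(i, l), (j, k)}"
    and t: "t = edge_mon i k + edge_mon j l"
    using assms(1) by cases (metis keys_edge_mon_add)+
  obtain i' j' k' l' where ord': "i' < j'" "j' < k'" "k' < l'"
    and s': "Poly_Mapping.keys s = {(i', j'), (k', l')} \<or> Poly_Mapping.keys s = {(i', l'), (j', k')}"
    and t': "t' = edge_mon i' k' + edge_mon j' l'"
    using assms(2) by cases (metis keys_edge_mon_add)+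
  have "{i, j, k, l} = fst ` Poly_Mapping.keys s \<union> snd ` Poly_Mapping.keys s"
    using s by (elim disjE) (simp_all add: insert_commute)
  moreover have "{i', j', k', l'} = fst ` Poly_Mapping.keys s \<union> snd ` Poly_Mapping.keys s"
    using s' by (elim disjE) (simp_all add: insert_commute)
  ultimately have set_eq: "set [i, j, k, l] = set [i', j', k', l']" by simp
  have "[i, j, k, l] = [i', j', k', l']"
    by (rule sorted_distinct_set_unique[OF _ _ _ _ set_eq]) (use * ord' in simp_all)
  then show ?thesis using t t' by simp
qed

text \<open>The first block on which the two monomials differ is at most the class of \<open>e\<close>, and there \<open>t\<close>
  restricts to \<open>1\<close>.\<close>

lemma circular_term_order_greater:
  assumes r: "circular_term_order p r"
    and M: "s \<in> monomials (edges {1..p})" "t \<in> monomials (edges {1..p})"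
    and e: "e \<in> Poly_Mapping.keys s" "e \<in> edge_class p d"
    and t: "\<And>e'. e' \<in> Poly_Mapping.keys t \<Longrightarrow> \<exists>d'>d. e' \<in> edge_class p d'"
  shows "(t, s) \<in> r"
proof -
  obtain ords where to: "\<And>d. d \<in> {1..p div 2} \<Longrightarrow> term_order (edge_class p d) (ords d)"
    and r_eq: "r = block_order (p div 2) (edge_class p) ords"
    using r unfolding circular_term_order_def by blast
  let ?R = "\<lambda>k. restrict_mon (edge_class p k)"
  have t0: "?R k t = 0" if "k \<le> d" for k
  proof (rule poly_mapping_eqI)
    fix x
    have "x \<notin> edge_class p k" if "x \<in> Poly_Mapping.keys t"
      using t[OF that] \<open>k \<le> d\<close> by (auto simp: edge_class_def)
    then show "Poly_Mapping.lookup (?R k t) x = Poly_Mapping.lookup 0 x"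
      by (auto simp: lookup_restrict_mon when_def in_keys_iff)
  qed
  have s0: "?R d s \<noteq> 0"
  proof
    assume "?R d s = 0"
    then have "Poly_Mapping.lookup (?R d s) e = 0" by simp
    then show False using e by (simp add: lookup_restrict_mon in_keys_iff)
  qed
  have d: "d \<in> {1..p div 2}" using e(2) by (auto simp: edge_class_def edges_def)
  have "t \<noteq> s" using t0[of d] s0 by auto
  obtain k where k: "k \<in> {1..p div 2}" "\<forall>l\<in>{1..<k}. ?R l t = ?R l s" "?R k t \<noteq> ?R k s"
    using first_difference[OF M(2,1)[folded Union_edge_class] \<open>t \<noteq> s\<close>] by blast
  have "k \<le> d"
  proof (rule ccontr)
    assume "\<not> k \<le> d"
    then have "?R d t = ?R d s" using k(2) d by simp
    then show False using t0[of d] s0 by simp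
  qed
  then have "?R k t = 0" by (rule t0)
  then have "(?R k t, ?R k s) \<in> ords k" using to[OF k(1)] restrict_mon_in by (auto simp: term_order_def)
  then show ?thesis using M k unfolding r_eq block_order_def Union_edge_class by blast
qed

text \<open>The shorter arc over the cyclically shorter diagonal of an inscribed quadrilateral contains one
  side from each pair of opposite sides, and that side is shorter than both diagonals.\<close>

lemma tetrad_terms_less:
  assumes r: "circular_term_order p r" and st: "(s, t) \<in> tetrad_terms n" and "n \<le> p"
  shows "(t, s) \<in> r"
proof -
  have "edges {1..n} \<subseteq> edges {1..p}" using \<open>n \<le> p\<close> by (auto simp: edges_def)
  then have M: "s \<in> monomials (edges {1..p})" "t \<in> monomials (edges {1..p})"
    using tetrad_terms_monomials[OF st] unfolding monomials_def by auto
  define cd where "cd i j = min (j - i) (p - (j - i))" for i j :: nat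
  have cl: "(i, j) \<in> edge_class p (cd i j)" if "(i, j) \<in> edges {1..p}" for i j
    using that by (simp add: edge_class_def cd_def)
  have tE: "Poly_Mapping.keys t \<subseteq> edges {1..p}" and sE: "Poly_Mapping.keys s \<subseteq> edges {1..p}"
    using M by (auto simp: monomials_def)
  \<comment> \<open>One edge of \<open>s\<close> that is cyclically shorter than both edges of
    \<open>t\<close> decides the comparison. Below it is always the shorter of two opposite
    sides.\<close>
  have less: "(t, s) \<in> r" if "(i, j) \<in> Poly_Mapping.keys s"
    "\<forall>(k, l)\<in>Poly_Mapping.keys t. cd i j < cd k l" for i j
  proof (rule circular_term_order_greater[OF r M that(1) cl])
    show "(i, j) \<in> edges {1..p}" using that(1) sE by blast
    show "\<exists>d'>cd i j. e' \<in> edge_class p d'" if e': "e' \<in> Poly_Mapping.keys t" for e'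
    proof (intro exI conjI)
      show "e' \<in> edge_class p (cd (fst e') (snd e'))" using cl[of "fst e'" "snd e'"] e' tE by auto
      show "cd i j < cd (fst e') (snd e')"
        using \<open>\<forall>(k, l)\<in>Poly_Mapping.keys t. cd i j < cd k l\<close> e' by (auto simp: case_prod_beta)
    qed
  qed
  \<comment> \<open>One arc of the first edge bounds its cyclic distance from above; it has to be
    shorter than both arcs of the second edge.\<close>
  have cd_less: "cd i j < cd k l" if "j - i < l - k" "j - i < p - (l - k)" for i j k l
    using that unfolding cd_def by simp
  show ?thesis
    using st
  proof cases
    case (disjoint i j k l)
    show ?thesis
    proof (cases "j - i \<le> l - k")
      case True
      have "cd i j < cd i k" "cd i j < cd j l"
        using True disjoint(3-) \<open>n \<le> p\<close> by (intro cd_less; arith)+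
      then show ?thesis using less[of i j] by (auto simp: disjoint(1,2) keys_edge_mon_add)
    next
      case False
      have "cd k l < cd i k" "cd k l < cd j l"
        using False disjoint(3-) \<open>n \<le> p\<close> by (intro cd_less; arith)+
      then show ?thesis using less[of k l] by (auto simp: disjoint(1,2) keys_edge_mon_add)
    qed
  next
    case (nested i j k l)
    \<comment> \<open>The edge \<open>il\<close> is measured along the arc that passes through
      \<open>p\<close>, since the other arc contains \<open>j\<close> and \<open>k\<close>.\<close>
    have swap: "cd i l < cd x y" if "p - (l - i) < y - x" "p - (l - i) < p - (y - x)" for x y
      using that unfolding cd_def by simp
    show ?thesis
    proof (cases "k - j \<le> p - (l - i)")
      case True
      have "cd j k < cd i k" "cd j k < cd j l"
        using True nested(3-) \<open>n \<le> p\<close> by (intro cd_less; arith)+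
      then show ?thesis using less[of j k] by (auto simp: nested(1,2) keys_edge_mon_add)
    next
      case False
      have "cd i l < cd i k" "cd i l < cd j l"
        using False nested(3-) \<open>n \<le> p\<close> by (intro swap; arith)+
      then show ?thesis using less[of i l] by (auto simp: nested(1,2) keys_edge_mon_add)
    qed
  qed
qed

lemma keys_monomial_diff:
  assumes "s \<noteq> t"
  shows "Poly_Mapping.keys (monomial_diff s t) = {s, t}"
  using assms by (auto simp: monomial_diff_def in_keys_iff lookup_minus lookup_single when_def split: if_splits)

lemma lead_monomial_diff:
  assumes "term_order X r" "(t, s) \<in> r" "s \<noteq> t"
  shows "lead_mon r (monomial_diff s t) = s" "Poly_Mapping.lookup (monomial_diff s t) s = 1"
proof -
  have "(s, s) \<in> r" and as: "antisym r"
    using assms(1,2) by (auto simp: term_order_def order_on_defs refl_on_def)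
  show "lead_mon r (monomial_diff s t) = s"
    by (rule lead_mon_eqI[OF as]) (use keys_monomial_diff[OF assms(3)] assms(2) \<open>(s, s) \<in> r\<close> in auto)
  show "Poly_Mapping.lookup (monomial_diff s t) s = 1"
    using assms(3) by (simp add: monomial_diff_def lookup_minus lookup_single when_def)
qed

lemma lead_single:
  assumes "term_order X r" "s \<in> monomials X" and "c \<noteq> 0"
  shows "lead_mon r (Poly_Mapping.single s c) = s"
  using assms by (intro lead_mon_eqI) (auto simp: term_order_def order_on_defs refl_on_def)

subsection \<open>Fibers of the toric parametrization\<close>

lemma vertex_degree_add:
  "vertex_degree E (Poly_Mapping.lookup (s + t)) v =
    vertex_degree E (Poly_Mapping.lookup s) v + vertex_degree E (Poly_Mapping.lookup t) v"
  by (simp add: vertex_degree_def lookup_add distrib_right sum.distrib)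

lemma vertex_degree_edge_mon:
  assumes "finite E" "(i, j) \<in> E"
  shows "vertex_degree E (Poly_Mapping.lookup (edge_mon i j)) v = of_bool (i = v) + of_bool (j = v)"
proof -
  have "vertex_degree E (Poly_Mapping.lookup (edge_mon i j)) v =
      (\<Sum>e\<in>{(i, j)}. Poly_Mapping.lookup (edge_mon i j) e * (of_bool (fst e = v) + of_bool (snd e = v)))"
    unfolding vertex_degree_def using assms
    by (intro sum.mono_neutral_right) (auto simp: edge_mon_def lookup_single when_def)
  then show ?thesis by (simp add: edge_mon_def)
qed

text \<open>Both pairs of edges cover each of the four vertices exactly once.\<close>

lemma vertex_degree_tetrad:
  assumes "(s, t) \<in> tetrad_terms n" "n \<le> p"
  shows "vertex_degree ({..p} \<times> {..p}) (Poly_Mapping.lookup s) = vertex_degree ({..p} \<times> {..p}) (Poly_Mapping.lookup t)"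
  using assms(1)
proof cases
  case (disjoint i j k l)
  then show ?thesis using assms(2) by (auto simp: vertex_degree_add vertex_degree_edge_mon)
next
  case (nested i j k l)
  then show ?thesis using assms(2) by (auto simp: vertex_degree_add vertex_degree_edge_mon)
qed

text \<open>Subtraction of exponents is truncated; it is a true quotient here because the exponent
  of \<open>(i, j)\<close> is at least one.\<close>

lemma edge_mon_dvd:
  assumes "(i, j) \<in> Poly_Mapping.keys m"
  shows "m = edge_mon i j + (m - edge_mon i j)"
  using assms
  by (intro poly_mapping_eqI) (auto simp: edge_mon_def lookup_add lookup_minus lookup_single when_def in_keys_iff)

lemma two_edges_dvd:
  assumes "(i, j) \<in> Poly_Mapping.keys m" "(k, l) \<in> Poly_Mapping.keys m" "(i, j) \<noteq> (k, l)"
  shows "m = edge_mon i j + edge_mon k l + (m - edge_mon i j - edge_mon k l)"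
proof -
  have "(k, l) \<in> Poly_Mapping.keys (m - edge_mon i j)"
    using assms(2,3) by (auto simp: edge_mon_def lookup_minus lookup_single when_def in_keys_iff)
  then show ?thesis using edge_mon_dvd[OF assms(1)] edge_mon_dvd by (metis add.assoc)
qed

lemma thrackle_lookup:
  assumes m: "m \<in> monomials (edges {1..n})"
    and standard: "\<And>s t u. (s, t) \<in> tetrad_terms n \<Longrightarrow> m \<noteq> s + u"
  shows "thrackle (Poly_Mapping.lookup m)"
  unfolding thrackle_def
proof (intro allI impI)
  fix i j k l assume "Poly_Mapping.lookup m (i, j) \<noteq> 0" "Poly_Mapping.lookup m (k, l) \<noteq> 0"
  then have keys: "(i, j) \<in> Poly_Mapping.keys m" "(k, l) \<in> Poly_Mapping.keys m" by (auto simp: in_keys_iff)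
  then have "(i, j) \<in> edges {1..n}" "(k, l) \<in> edges {1..n}" using m by (auto simp: monomials_def)
  then have bounds: "1 \<le> i" "i < j" "j \<le> n" "1 \<le> k" "k < l" "l \<le> n" by (auto simp: edges_def)
  show "k \<le> j \<and> \<not> (i < k \<and> l < j)"
  proof (rule ccontr)
    assume "\<not> (k \<le> j \<and> \<not> (i < k \<and> l < j))"
    \<comment> \<open>The two ways to violate the thrackle condition are the two non-crossing
      positions: \<open>i < j < k < l\<close>, and \<open>i < k < l < j\<close>, where the tetrad
      has the vertices in the order \<open>i\<close>, \<open>k\<close>, \<open>l\<close>,
      \<open>j\<close>.\<close>
    then consider "j < k" | "i < k" "l < j" by linarith
    then show False
    proof cases
      case 1
      then have "(i, j) \<noteq> (k, l)" using bounds by auto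
      then show False
        using standard[OF tetrad_terms.disjoint[of i j k l]] two_edges_dvd[OF keys] 1 bounds by blast
    next
      case 2
      then have "(i, j) \<noteq> (k, l)" by auto
      then show False
        using standard[OF tetrad_terms.nested[of i k l j]] two_edges_dvd[OF keys] 2 bounds by blast
    qed
  qed
qed

lemma lookup_edges_le:
  assumes "m \<in> monomials (edges {1..n})" "Poly_Mapping.lookup m (i, j) \<noteq> 0"
  shows "i \<le> n \<and> j \<le> n"
proof -
  have "(i, j) \<in> edges {1..n}" using assms unfolding monomials_def by (auto simp: in_keys_iff)
  then show ?thesis by (simp add: edges_def)
qed

text \<open>Every exponent is at most the degree of an end of its edge. Finiteness provides a
  smallest monomial in the fiber without appeal to well-foundedness of term orders.\<close>

lemma finite_fiber:
  assumes "n \<le> p"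
  shows "finite {m \<in> monomials (edges {1..n}). vertex_degree ({..p} \<times> {..p}) (Poly_Mapping.lookup m) = d}"
    (is "finite ?F")
proof -
  let ?B = "\<Sum>v\<le>p. d v"
  have "Poly_Mapping.lookup ` ?F \<subseteq>
      {f. \<forall>x. (x \<in> {..p} \<times> {..p} \<longrightarrow> f x \<in> {..?B}) \<and> (x \<notin> {..p} \<times> {..p} \<longrightarrow> f x = 0)}"
  proof (intro image_subsetI CollectI allI conjI impI)
    fix m e assume "m \<in> ?F"
    then have m: "m \<in> monomials (edges {1..n})" and d: "vertex_degree ({..p} \<times> {..p}) (Poly_Mapping.lookup m) = d"
      by auto
    show "Poly_Mapping.lookup m e = 0" if "e \<notin> {..p} \<times> {..p}"
      using that lookup_edges_le[OF m, of "fst e" "snd e"] assms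
      by (metis atMost_iff mem_Times_iff order_trans prod.collapse)
    show "Poly_Mapping.lookup m e \<in> {..?B}" if e: "e \<in> {..p} \<times> {..p}"
    proof -
      let ?f = "\<lambda>e'. Poly_Mapping.lookup m e' * (of_bool (fst e' = fst e) + of_bool (snd e' = fst e))"
      have "Poly_Mapping.lookup m e \<le> ?f e" by simp
      also have "\<dots> \<le> vertex_degree ({..p} \<times> {..p}) (Poly_Mapping.lookup m) (fst e)"
        unfolding vertex_degree_def by (rule member_le_sum[OF e]) auto
      also have "\<dots> \<le> ?B" unfolding d using e by (intro member_le_sum) auto
      finally show ?thesis by simp
    qed
  qed
  then have "finite (Poly_Mapping.lookup ` ?F)"
    by (rule finite_subset) (intro finite_set_of_finite_funs finite_SigmaI finite_atMost)
  then show ?thesis by (rule finite_imageD) (simp add: inj_on_def poly_mapping.lookup_inject)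
qed

text \<open>The smallest monomial with given vertex degrees is standard (divisible by no leading monomial of
  a tetrad), hence a thrackle, and the vertex degrees determine the thrackle.\<close>

lemma standard_monomial_least:
  assumes r: "circular_term_order p r" and "n \<le> p"
    and m: "m \<in> monomials (edges {1..n})"
    and standard: "\<And>s t u. (s, t) \<in> tetrad_terms n \<Longrightarrow> m \<noteq> s + u"
    and m': "m' \<in> monomials (edges {1..n})"
    and deg: "vertex_degree ({..p} \<times> {..p}) (Poly_Mapping.lookup m') = vertex_degree ({..p} \<times> {..p}) (Poly_Mapping.lookup m)"
  shows "(m, m') \<in> r"
proof -
  let ?E = "{..p} \<times> {..p}"
  define F where "F = {m' \<in> monomials (edges {1..n}). vertex_degree ?E (Poly_Mapping.lookup m') = vertex_degree ?E (Poly_Mapping.lookup m)}"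
  have edges: "edges {1..n} \<subseteq> edges {1..p}" using \<open>n \<le> p\<close> by (auto simp: edges_def)
  then have mono: "monomials (edges {1..n}) \<subseteq> monomials (edges {1..p})" by (auto simp: monomials_def)
  have to: "term_order (edges {1..p}) r" by (rule circular_term_order_is_term_order[OF r])
  then have "linear_order_on (monomials (edges {1..p})) (r\<inverse>)" and as: "antisym r"
    by (auto simp: term_order_def order_on_defs)
  moreover have "finite F" unfolding F_def by (rule finite_fiber[OF \<open>n \<le> p\<close>])
  moreover have "m \<in> F" using m by (simp add: F_def)
  moreover have "F \<subseteq> monomials (edges {1..p})" using mono by (auto simp: F_def)
  ultimately obtain m0 where m0: "m0 \<in> F" "\<forall>m'\<in>F. (m0, m') \<in> r"
    using linear_order_finite_greatest[of "monomials (edges {1..p})" "r\<inverse>" F] by auto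
  have supp: "i \<le> p \<and> j \<le> p"
    if "Poly_Mapping.lookup m (i, j) \<noteq> 0" "m \<in> monomials (edges {1..n})" for i j m
    using lookup_edges_le[OF that(2,1)] \<open>n \<le> p\<close> by simp
  have standard0: "m0 \<noteq> s + u" if st: "(s, t) \<in> tetrad_terms n" for s t u
  proof
    assume m0_eq: "m0 = s + u"
    have "Poly_Mapping.keys u \<subseteq> Poly_Mapping.keys m0"
      by (auto simp: m0_eq in_keys_iff lookup_add)
    then have u: "u \<in> monomials (edges {1..n})" using m0(1) by (auto simp: F_def monomials_def)
    \<comment> \<open>Replacing the factor \<open>s\<close> by \<open>t\<close> stays in the fiber
      and does not increase the monomial, so minimality of \<open>m0\<close> would force
      \<open>s = t\<close>.\<close>
    have "vertex_degree ?E (Poly_Mapping.lookup (t + u)) = vertex_degree ?E (Poly_Mapping.lookup m0)"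
      using vertex_degree_tetrad[OF st \<open>n \<le> p\<close>] by (simp add: m0_eq vertex_degree_add fun_eq_iff)
    moreover have "t + u \<in> monomials (edges {1..n})"
      using monomials_add tetrad_terms_monomials(2)[OF st] u by blast
    ultimately have "t + u \<in> F" using m0(1) by (simp add: F_def)
    then have "(s + u, t + u) \<in> r" using m0(2) m0_eq by simp
    moreover have "(t + u, s + u) \<in> r"
      using to tetrad_terms_less[OF r st \<open>n \<le> p\<close>] u mono unfolding term_order_def by blast
    ultimately have "s = t" using as by (auto dest: antisymD)
    then show False using tetrad_lead_ne_trail[OF st st] by simp
  qed
  have "Poly_Mapping.lookup m = Poly_Mapping.lookup m0"
  proof (rule thrackle_unique)
    show "thrackle (Poly_Mapping.lookup m)" using thrackle_lookup[OF m standard] .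
    show "thrackle (Poly_Mapping.lookup m0)" using thrackle_lookup[OF _ standard0] m0(1) by (auto simp: F_def)
    show "i \<le> p \<and> j \<le> p" if "Poly_Mapping.lookup m (i, j) \<noteq> 0" for i j by (rule supp[OF that m])
    show "i \<le> p \<and> j \<le> p" if "Poly_Mapping.lookup m0 (i, j) \<noteq> 0" for i j
      by (rule supp[OF that]) (use m0(1) in \<open>simp add: F_def\<close>)
  qed (use m0(1) in \<open>simp add: F_def\<close>)
  then have "m = m0" by (simp add: poly_mapping.lookup_inject)
  moreover have "m' \<in> F" using m' deg by (simp add: F_def)
  ultimately show ?thesis using m0(2) by simp
qed

text \<open>On the curve \<open>\<lambda>\<^sub>i = x ^ (N ^ i)\<close> a monomial becomes \<open>x\<close> to the power whose base-\<open>N\<close> digits are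
  its vertex degrees, so for large \<open>N\<close> the coefficients of each fiber sum to zero.\<close>

lemma one_factor_ideal_fiber:
  assumes f: "f \<in> one_factor_ideal {1..n} {n + 1..p}" and "n \<le> p"
    and m: "m \<in> Poly_Mapping.keys f" "m \<in> monomials (edges {1..n})"
  obtains m' where "m' \<in> Poly_Mapping.keys f" "m' \<in> monomials (edges {1..n})" "m' \<noteq> m"
    "vertex_degree ({..p} \<times> {..p}) (Poly_Mapping.lookup m') = vertex_degree ({..p} \<times> {..p}) (Poly_Mapping.lookup m)"
proof -
  let ?E = "{..p} \<times> {..p}"
  let ?D = "\<lambda>m. vertex_degree ?E (Poly_Mapping.lookup m)"
  define K where "K = {m \<in> Poly_Mapping.keys f. m \<in> monomials (edges {1..n})}"
  have un: "{1..n} \<union> {n + 1..p} = {1..p}" using \<open>n \<le> p\<close> by auto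
  have f_keys: "Poly_Mapping.keys f \<subseteq> monomials (edges {1..p})"
    using f unfolding one_factor_ideal_def un carrier_poly_ring by blast
  \<comment> \<open>\<open>N\<close> exceeds every vertex degree of every monomial of
    \<open>f\<close>, so the degrees are valid base-\<open>N\<close> digits.\<close>
  have "finite ((\<lambda>(m, v). ?D m v) ` (Poly_Mapping.keys f \<times> {..p}))" by simp
  then obtain N where N: "\<forall>d\<in>(\<lambda>(m, v). ?D m v) ` (Poly_Mapping.keys f \<times> {..p}). d < N"
    unfolding finite_nat_set_iff_bounded by blast
  define w where "w m = (\<Sum>v<Suc p. ?D m v * N ^ v)" for m
  have w: "w m = (\<Sum>e\<in>Poly_Mapping.keys m. Poly_Mapping.lookup m e * (N ^ fst e + N ^ snd e))"
    if "m \<in> monomials (edges {1..n})" for m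
  proof -
    have sub: "Poly_Mapping.keys m \<subseteq> ?E" using that \<open>n \<le> p\<close> by (auto simp: monomials_def edges_def)
    have "w m = (\<Sum>e\<in>?E. Poly_Mapping.lookup m e * (N ^ fst e + N ^ snd e))"
      unfolding w_def lessThan_Suc_atMost by (rule sum_vertex_degree) auto
    also have "\<dots> = (\<Sum>e\<in>Poly_Mapping.keys m. Poly_Mapping.lookup m e * (N ^ fst e + N ^ snd e))"
      using sub by (intro sum.mono_neutral_right) (auto simp: in_keys_iff)
    finally show ?thesis .
  qed
  have "(\<Sum>m\<in>K. Poly_Mapping.lookup f m * x ^ w m) = 0" for x :: real
  proof -
    \<comment> \<open>The factor loadings vanish on the isolated vertices, and the identity matrix
      serves as the diagonal part; it is invisible to the off-diagonal entries.\<close>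
    define lam where "lam i = (if i \<in> {1..n} then x ^ (N ^ i) else 0)" for i
    define S where "S i j = of_bool (i = j) + lam i * lam j" for i j
    have S_model: "S \<in> one_factor_model {1..n} {n + 1..p}"
      unfolding one_factor_model_def S_def lam_def
      by (rule CollectI, rule exI[of _ "\<lambda>i j. of_bool (i = j)"], rule exI[of _ "\<lambda>i. if i \<in> {1..n} then x ^ (N ^ i) else 0"]) auto
    have S_eq: "S (fst e) (snd e) = lam (fst e) * lam (snd e)" if "e \<in> edges {1..p}" for e
      using that by (auto simp: S_def edges_def)
    have val: "eval_mon (\<lambda>(i, j). S i j) m = (if m \<in> monomials (edges {1..n}) then x ^ w m else 0)"
      if m: "m \<in> monomials (edges {1..p})" for m
    proof (cases "m \<in> monomials (edges {1..n})")
      case True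
      have "eval_mon (\<lambda>(i, j). S i j) m =
          (\<Prod>e\<in>Poly_Mapping.keys m. x ^ (Poly_Mapping.lookup m e * (N ^ fst e + N ^ snd e)))"
        unfolding eval_mon_def
      proof (rule prod.cong[OF refl])
        fix e assume "e \<in> Poly_Mapping.keys m"
        then have "e \<in> edges {1..n}" "e \<in> edges {1..p}" using True m by (auto simp: monomials_def)
        then have "(case e of (i, j) \<Rightarrow> S i j) = x ^ (N ^ fst e + N ^ snd e)"
          using S_eq[of e] by (auto simp: lam_def edges_def power_add)
        then show "(case e of (i, j) \<Rightarrow> S i j) ^ Poly_Mapping.lookup m e =
            x ^ (Poly_Mapping.lookup m e * (N ^ fst e + N ^ snd e))"
          by (simp add: power_mult[symmetric] mult.commute)
      qed
      then show ?thesis using True by (simp add: w power_sum)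
    next
      case False
      then obtain e where e: "e \<in> Poly_Mapping.keys m" "e \<notin> edges {1..n}" by (auto simp: monomials_def)
      then have eE: "e \<in> edges {1..p}" using m by (auto simp: monomials_def)
      then have "(case e of (i, j) \<Rightarrow> S i j) = 0"
        using S_eq[OF eE] e(2) eE by (auto simp: lam_def edges_def split: if_splits)
      then have "(case e of (i, j) \<Rightarrow> S i j) ^ Poly_Mapping.lookup m e = 0"
        using e(1) by (simp add: in_keys_iff)
      then have "eval_mon (\<lambda>(i, j). S i j) m = 0"
        unfolding eval_mon_def using e(1) by (intro prod_zero) auto
      then show ?thesis using False by simp
    qed
    have "0 = eval_poly (\<lambda>(i, j). S i j) f"
      using f S_model by (simp add: one_factor_ideal_def)
    also have "\<dots> = (\<Sum>m\<in>Poly_Mapping.keys f. Poly_Mapping.lookup f m * (if m \<in> monomials (edges {1..n}) then x ^ w m else 0))"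
      unfolding eval_poly_superset[OF finite_keys order_refl]
      using f_keys val by (intro sum.cong) auto
    also have "\<dots> = (\<Sum>m\<in>K. Poly_Mapping.lookup f m * x ^ w m)"
      unfolding K_def by (intro sum.mono_neutral_cong_right) auto
    finally show ?thesis by simp
  qed
  then have sum_0: "(\<Sum>m' | m' \<in> K \<and> w m' = w m. Poly_Mapping.lookup f m') = 0"
    by (intro sum_power_coeff_eq_0) (simp_all add: K_def)
  \<comment> \<open>If \<open>m\<close> were alone in its weight class, the vanishing sum would be
    its own nonzero coefficient.\<close>
  have "\<exists>m'\<in>K. w m' = w m \<and> m' \<noteq> m"
  proof (rule ccontr)
    assume "\<not> ?thesis"
    then have "{m' \<in> K. w m' = w m} = {m}" using m by (auto simp: K_def)
    then show False using sum_0 m(1) by (simp add: in_keys_iff)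
  qed
  then obtain m' where m': "m' \<in> K" "w m' = w m" "m' \<noteq> m" by blast
  have "?D m' v = ?D m v" for v
  proof (cases "v \<le> p")
    case True
    have bound: "?D m v < N" if "m \<in> Poly_Mapping.keys f" "v < Suc p" for m v
      using N that by (auto simp: less_Suc_eq_le)
    show ?thesis
    proof (rule digit_sum_inject[of "Suc p" "?D m'" N "?D m"])
      show "?D m' v < N" "?D m v < N" if "v < Suc p" for v
        using that m(1) m'(1) bound by (auto simp: K_def)
      show "(\<Sum>i<Suc p. ?D m' i * N ^ i) = (\<Sum>i<Suc p. ?D m i * N ^ i)"
        using m'(2) by (simp only: w_def)
    qed (use True in simp)
  next
    case False
    then have "fst e \<noteq> v" "snd e \<noteq> v" if "e \<in> ?E" for e using that by auto
    then show ?thesis by (simp add: vertex_degree_def)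
  qed
  then show thesis using that m' by (auto simp: K_def)
qed

subsection \<open>The Groebner basis\<close>

text \<open>The two edges are distinct. So divisibility between tetrad monomials reduces to
  inclusion of two-element supports, that is, to equality.\<close>

lemma tetrad_squarefree:
  assumes "(s, t) \<in> tetrad_terms n" "m \<in> {s, t}"
  shows "Poly_Mapping.lookup m e = of_bool (e \<in> Poly_Mapping.keys m)" "card (Poly_Mapping.keys m) = 2"
proof -
  obtain i j k l where m: "m = edge_mon i j + edge_mon k l" "(i, j) \<noteq> (k, l)"
    using assms by (cases, auto)
  show "Poly_Mapping.lookup m e = of_bool (e \<in> Poly_Mapping.keys m)"
    using m(2) unfolding m(1) keys_edge_mon_add
    by (auto simp: edge_mon_def lookup_add lookup_single when_def)
  show "card (Poly_Mapping.keys m) = 2"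
    using m(2) unfolding m(1) keys_edge_mon_add by simp
qed

lemma tetrad_terms_dvd_imp_eq:
  assumes st: "(s, t) \<in> tetrad_terms n" and st': "(s', t') \<in> tetrad_terms n"
    and m: "m \<in> {s', t'}" "m = s + u"
  shows "m = s"
proof -
  have "Poly_Mapping.keys s \<subseteq> Poly_Mapping.keys m" by (auto simp: m(2) in_keys_iff lookup_add)
  then have "Poly_Mapping.keys s = Poly_Mapping.keys m"
    using tetrad_squarefree(2)[OF st, of s] tetrad_squarefree(2)[OF st' m(1)]
    by (intro card_subset_eq) auto
  then show ?thesis
    using tetrad_squarefree(1)[OF st, of s] tetrad_squarefree(1)[OF st' m(1)]
    by (intro poly_mapping_eqI) simp
qed

lemma finite_tetrad_terms: "finite (tetrad_terms n)"
proof -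
  let ?q = "\<lambda>(i, j, k, l). {(edge_mon i j + edge_mon k l, edge_mon i k + edge_mon j l),
    (edge_mon i l + edge_mon j k, edge_mon i k + edge_mon j l)}"
  have "tetrad_terms n \<subseteq> (\<Union>x\<in>{..n} \<times> {..n} \<times> {..n} \<times> {..n}. ?q x)"
  proof (rule subrelI)
    fix s t assume "(s, t) \<in> tetrad_terms n"
    then show "(s, t) \<in> (\<Union>x\<in>{..n} \<times> {..n} \<times> {..n} \<times> {..n}. ?q x)"
    proof cases
      case (disjoint i j k l)
      then show ?thesis by (intro UN_I[of "(i, j, k, l)"]) auto
    next
      case (nested i j k l)
      then show ?thesis by (intro UN_I[of "(i, j, k, l)"]) auto
    qed
  qed
  then show ?thesis by (rule finite_subset) auto
qed

lemma ideal_one_factor_ideal: "ideal (one_factor_ideal A B) (poly_ring (edges (A \<union> B)))"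
proof -
  have "one_factor_ideal A B = {f \<in> carrier (poly_ring (edges (A \<union> B))).
      \<forall>v\<in>(\<lambda>S. \<lambda>(i, j). S i j) ` one_factor_model A B. eval_poly v f = 0}"
    by (simp add: one_factor_ideal_def)
  then show ?thesis by (simp only: ideal_vanishing)
qed

text \<open>Variables are indexed by pairs \<open>i < j\<close>, so the diagonal matrix never
  contributes to an evaluation.\<close>

lemma one_factor_modelD:
  assumes "S \<in> one_factor_model A B"
  shows "\<exists>lam. (\<forall>i\<in>B. lam i = 0) \<and> (\<forall>i j. (i, j) \<in> edges (A \<union> B) \<longrightarrow> S i j = lam i * lam j)"
proof -
  obtain \<Omega> lam where S: "S = (\<lambda>i j. \<Omega> i j + lam i * lam j)"
    and \<Omega>: "\<forall>i\<in>A \<union> B. \<forall>j\<in>A \<union> B. i \<noteq> j \<longrightarrow> \<Omega> i j = 0" and lam: "\<forall>i\<in>B. lam i = 0"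
    using assms unfolding one_factor_model_def by blast
  have "S i j = lam i * lam j" if "(i, j) \<in> edges (A \<union> B)" for i j
    using that \<Omega> by (simp add: S edges_def)
  with lam show ?thesis by blast
qed

lemma tetrad_in_one_factor_ideal:
  assumes st: "(s, t) \<in> tetrad_terms n" and "n \<le> p"
  shows "monomial_diff s t \<in> one_factor_ideal {1..n} {n + 1..p}"
proof -
  have un: "{1..n} \<union> {n + 1..p} = {1..p}" using \<open>n \<le> p\<close> by auto
  have "edges {1..n} \<subseteq> edges {1..p}" using \<open>n \<le> p\<close> by (auto simp: edges_def)
  then have "{s, t} \<subseteq> monomials (edges {1..p})"
    using tetrad_terms_monomials[OF st] by (auto simp: monomials_def)
  then have "monomial_diff s t \<in> carrier (poly_ring (edges {1..p}))"
    using keys_monomial_diff[OF tetrad_lead_ne_trail[OF st st]] by (simp add: carrier_poly_ring)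
  moreover have "eval_poly (\<lambda>(i, j). S i j) (monomial_diff s t) = 0"
    if S: "S \<in> one_factor_model {1..n} {n + 1..p}" for S
  proof -
    obtain lam where lam: "\<And>i j. (i, j) \<in> edges {1..p} \<Longrightarrow> S i j = lam i * lam j"
      using one_factor_modelD[OF S] unfolding un by blast
    show ?thesis
      using st
    proof cases
      case (disjoint i j k l)
      then show ?thesis using \<open>n \<le> p\<close>
        by (simp add: monomial_diff_def eval_poly_diff eval_mon_add edge_mon_def lam edges_def)
    next
      case (nested i j k l)
      then show ?thesis using \<open>n \<le> p\<close>
        by (simp add: monomial_diff_def eval_poly_diff eval_mon_add edge_mon_def lam edges_def)
    qed
  qed
  ultimately show ?thesis unfolding one_factor_ideal_def un by blast
qed

lemma edge_in_one_factor_ideal: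
  assumes "n \<le> p" "(i, j) \<in> edges {1..p}" "(i, j) \<notin> edges {1..n}"
  shows "Poly_Mapping.single (edge_mon i j) 1 \<in> one_factor_ideal {1..n} {n + 1..p}"
proof -
  have un: "{1..n} \<union> {n + 1..p} = {1..p}" using \<open>n \<le> p\<close> by auto
  have "eval_poly (\<lambda>(i, j). S i j) (Poly_Mapping.single (edge_mon i j) 1) = 0"
    if S: "S \<in> one_factor_model {1..n} {n + 1..p}" for S
  proof -
    obtain lam where lam: "\<forall>i\<in>{n + 1..p}. lam i = 0" "\<And>i j. (i, j) \<in> edges {1..p} \<Longrightarrow> S i j = lam i * lam j"
      using one_factor_modelD[OF S] unfolding un by blast
    have "i \<in> {n + 1..p} \<or> j \<in> {n + 1..p}" using assms(2,3) by (auto simp: edges_def)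
    then have "S i j = 0" using lam(1) lam(2)[OF assms(2)] by auto
    then show ?thesis by (simp add: edge_mon_def)
  qed
  moreover have "Poly_Mapping.single (edge_mon i j) 1 \<in> carrier (poly_ring (edges {1..p}))"
    using assms(2) by (simp add: carrier_poly_ring monomials_def edge_mon_def)
  ultimately show ?thesis unfolding one_factor_ideal_def un by blast
qed

text \<open>This leaves the degree-one generators to finish: the leading monomial has an edge with
  an end above \<open>n\<close>, and the variable of that edge divides it.\<close>

lemma standard_lead_mon_edges:
  assumes r: "circular_term_order p r" and "n \<le> p"
    and f: "f \<in> one_factor_ideal {1..n} {n + 1..p}" "f \<noteq> 0"
    and std: "\<And>s t u. (s, t) \<in> tetrad_terms n \<Longrightarrow> lead_mon r f \<noteq> s + u"
  shows "\<not> Poly_Mapping.keys (lead_mon r f) \<subseteq> edges {1..n}"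
proof
  assume "Poly_Mapping.keys (lead_mon r f) \<subseteq> edges {1..n}"
  then have m: "lead_mon r f \<in> monomials (edges {1..n})" by (simp add: monomials_def)
  have un: "{1..n} \<union> {n + 1..p} = {1..p}" using \<open>n \<le> p\<close> by auto
  have to: "term_order (edges {1..p}) r" by (rule circular_term_order_is_term_order[OF r])
  have carr: "f \<in> carrier (poly_ring (edges {1..p}))"
    using f(1) unfolding one_factor_ideal_def un by blast
  note lead = lead_mon_greatest[OF to f(2) carr]
  obtain m' where m': "m' \<in> Poly_Mapping.keys f" "m' \<in> monomials (edges {1..n})" "m' \<noteq> lead_mon r f"
    "vertex_degree ({..p} \<times> {..p}) (Poly_Mapping.lookup m') =
     vertex_degree ({..p} \<times> {..p}) (Poly_Mapping.lookup (lead_mon r f))"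
    by (rule one_factor_ideal_fiber[OF f(1) \<open>n \<le> p\<close> lead(1) m])
  have "(lead_mon r f, m') \<in> r"
    by (rule standard_monomial_least[OF r \<open>n \<le> p\<close> m std m'(2,4)])
  moreover have "antisym r" using to by (auto simp: term_order_def order_on_defs)
  ultimately show False using lead(2)[OF m'(1)] m'(3) by (auto dest: antisymD)
qed

lemma reduced_groebner_basis_one_factor:
  assumes r: "circular_term_order p r" and np: "n \<le> p"
  shows "reduced_groebner_basis (edges {1..p}) r
    ((\<lambda>(i, j). Poly_Mapping.single (edge_mon i j) 1) ` (edges {1..p} - edges {1..n}) \<union>
      (\<lambda>(s, t). monomial_diff s t) ` tetrad_terms n)
    (one_factor_ideal {1..n} {n + 1..p})"
    (is "reduced_groebner_basis _ _ (?E \<union> ?T) ?I")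
proof -
  have un: "{1..n} \<union> {n + 1..p} = {1..p}" using np by auto
  have to: "term_order (edges {1..p}) r" by (rule circular_term_order_is_term_order[OF r])
  have lead_E: "lead_mon r (Poly_Mapping.single (edge_mon i j) (1::real)) = edge_mon i j"
    if "(i, j) \<in> edges {1..p}" for i j
    using that by (intro lead_single[OF to]) (auto simp: monomials_def edge_mon_def)
  have lead_T: "lead_mon r (monomial_diff s t) = s" "Poly_Mapping.lookup (monomial_diff s t) s = 1"
    if "(s, t) \<in> tetrad_terms n" for s t
    using lead_monomial_diff[OF to tetrad_terms_less[OF r that np] tetrad_lead_ne_trail[OF that that]] by auto
  have keys_E: "Poly_Mapping.keys (edge_mon i j) = {(i, j)}" for i j by (simp add: edge_mon_def)
  have keys_T: "Poly_Mapping.keys s \<subseteq> edges {1..n}" "Poly_Mapping.keys t \<subseteq> edges {1..n}"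
    if "(s, t) \<in> tetrad_terms n" for s t
    using tetrad_terms_monomials[OF that] by (auto simp: monomials_def)
  have keys_dvd: "Poly_Mapping.keys s \<subseteq> Poly_Mapping.keys m" if "m = s + u" for m s u :: "(nat \<times> nat) mon"
    by (auto simp: that in_keys_iff lookup_add)
  have gen: thesis
    if "g \<in> ?E \<union> ?T"
      "\<And>i j. (i, j) \<in> edges {1..p} \<Longrightarrow> (i, j) \<notin> edges {1..n} \<Longrightarrow> g = Poly_Mapping.single (edge_mon i j) 1 \<Longrightarrow>
        lead_mon r g = edge_mon i j \<Longrightarrow> Poly_Mapping.keys g = {edge_mon i j} \<Longrightarrow> thesis"
      "\<And>s t. (s, t) \<in> tetrad_terms n \<Longrightarrow> g = monomial_diff s t \<Longrightarrow>
        lead_mon r g = s \<Longrightarrow> Poly_Mapping.keys g = {s, t} \<Longrightarrow> thesis" for g thesis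
    using that(1)
  proof
    assume "g \<in> ?E"
    then obtain i j where ij: "(i, j) \<in> edges {1..p}" "(i, j) \<notin> edges {1..n}"
      and g: "g = Poly_Mapping.single (edge_mon i j) 1" by auto
    show thesis by (rule that(2)[OF ij g]) (simp_all add: g lead_E[OF ij(1)])
  next
    assume "g \<in> ?T"
    then obtain s t where st: "(s, t) \<in> tetrad_terms n" and g: "g = monomial_diff s t" by auto
    show thesis
      by (rule that(3)[OF st g]) (simp_all add: g lead_T[OF st] keys_monomial_diff tetrad_lead_ne_trail[OF st st])
  qed
  have monic: "Poly_Mapping.lookup g (lead_mon r g) = 1" if "g \<in> ?E \<union> ?T" for g
    using that by (rule gen) (auto simp: lead_T lead_E)
  have "groebner_basis (edges {1..p}) r (?E \<union> ?T) ?I"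
  proof (rule groebner_basisI[OF to])
    show "ideal ?I (poly_ring (edges {1..p}))"
      using ideal_one_factor_ideal[of "{1..n}" "{n + 1..p}"] unfolding un .
    have "edges {1..p} \<subseteq> {..p} \<times> {..p}" by (auto simp: edges_def)
    then have "finite (edges {1..p})" by (rule finite_subset) simp
    then show "finite (?E \<union> ?T)" using finite_tetrad_terms by simp
    show "?E \<union> ?T \<subseteq> ?I"
      using edge_in_one_factor_ideal[OF np] tetrad_in_one_factor_ideal[OF _ np] by auto
    show "\<exists>g\<in>?E \<union> ?T. \<exists>u. lead_mon r f = lead_mon r g + u" if f: "f \<in> ?I" "f \<noteq> 0" for f
    proof (cases "\<exists>s t u. (s, t) \<in> tetrad_terms n \<and> lead_mon r f = s + u")
      case True
      then obtain s t u where st: "(s, t) \<in> tetrad_terms n" "lead_mon r f = s + u" by blast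
      then have "monomial_diff s t \<in> ?E \<union> ?T" by auto
      then show ?thesis using st lead_T(1)[OF st(1)] by metis
    next
      case False
      then have "\<not> Poly_Mapping.keys (lead_mon r f) \<subseteq> edges {1..n}"
        by (intro standard_lead_mon_edges[OF r np f]) blast
      then obtain i j where ij: "(i, j) \<in> Poly_Mapping.keys (lead_mon r f)" "(i, j) \<notin> edges {1..n}" by auto
      have carr: "f \<in> carrier (poly_ring (edges {1..p}))"
        using f(1) unfolding one_factor_ideal_def un by blast
      then have "lead_mon r f \<in> monomials (edges {1..p})"
        using lead_mon_greatest(1)[OF to f(2) carr] by (auto simp: carrier_poly_ring)
      then have "(i, j) \<in> edges {1..p}" using ij(1) by (auto simp: monomials_def)
      then have "Poly_Mapping.single (edge_mon i j) 1 \<in> ?E \<union> ?T"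
        and "lead_mon r (Poly_Mapping.single (edge_mon i j) (1::real)) = edge_mon i j"
        using ij(2) lead_E by auto
      then show ?thesis using edge_mon_dvd[OF ij(1)] by metis
    qed
  qed (rule monic)
  moreover have "m \<noteq> lead_mon r g + u"
    if g: "g \<in> ?E \<union> ?T" and h: "h \<in> ?E \<union> ?T" "h \<noteq> g" and m: "m \<in> Poly_Mapping.keys h" for g h m u
  proof
    assume dvd: "m = lead_mon r g + u"
    \<comment> \<open>Reducedness is decided on supports. An edge outside \<open>{1..n}\<close>
      occurs in no tetrad, a tetrad monomial has two edges and so divides no variable, and two
      distinct variables do not divide each other; only tetrad against tetrad needs more.\<close>
    note sub = keys_dvd[OF dvd]
    show False
      using g
    proof (rule gen)
      fix i j assume ij: "(i, j) \<notin> edges {1..n}" "g = Poly_Mapping.single (edge_mon i j) 1"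
        and lead: "lead_mon r g = edge_mon i j"
      from h(1) show False
      proof (rule gen)
        fix i' j' assume "h = Poly_Mapping.single (edge_mon i' j') 1" "Poly_Mapping.keys h = {edge_mon i' j'}"
        then show False using sub m h(2) ij lead by (simp add: keys_E)
      next
        fix s t assume "(s, t) \<in> tetrad_terms n" "Poly_Mapping.keys h = {s, t}"
        then show False using sub m ij(1) lead keys_T[of s t] by (auto simp: keys_E)
      qed
    next
      fix s t assume st: "(s, t) \<in> tetrad_terms n" "g = monomial_diff s t" and lead: "lead_mon r g = s"
      from h(1) show False
      proof (rule gen)
        fix i' j' assume "(i', j') \<notin> edges {1..n}" "Poly_Mapping.keys h = {edge_mon i' j'}"
        then have "Poly_Mapping.keys s \<subseteq> {(i', j')}" "(i', j') \<notin> Poly_Mapping.keys s"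
          using sub m lead keys_T(1)[OF st(1)] keys_E[of i' j'] by auto
        then have "Poly_Mapping.keys s = {}" by blast
        then show False using tetrad_squarefree(2)[OF st(1), of s] by simp
      next
        fix s' t' assume st': "(s', t') \<in> tetrad_terms n" "h = monomial_diff s' t'" and "Poly_Mapping.keys h = {s', t'}"
        then have m': "m \<in> {s', t'}" using m by simp
        then have "m = s" using tetrad_terms_dvd_imp_eq[OF st(1) st'(1)] dvd lead by blast
        \<comment> \<open>Being a leading monomial, \<open>m\<close> cannot be the trailing term of
          another tetrad, so it is its leading term, which determines the tetrad.\<close>
        then have "s = s'" using m' tetrad_lead_ne_trail[OF st(1) st'(1)] by auto
        then show False using tetrad_lead_inject[of s t n t'] st st' h(2) by auto
      qed
    qed
  qed
  ultimately show ?thesis using monic by (intro reduced_groebner_basisI)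
qed

theorem proposition3p7:
  fixes p :: nat and A B :: "nat set" and r :: "(nat \<times> nat) mon rel"
  assumes "A \<union> B = {1..p}" and "A \<inter> B = {}"
    and "A = {1..card A}" and "B = {card A + 1..p}"
    and "circular_term_order p r"
  shows "reduced_groebner_basis (edges {1..p}) r
           ({sigma i j | i j. (i, j) \<in> edges {1..p} \<and> (i \<in> B \<or> j \<in> B)} \<union>
            (\<Union>(i, j, k, l) \<in> {(i, j, k, l). 1 \<le> i \<and> i < j \<and> j < k \<and> k < l \<and> l \<le> card A}.
               {sigma i j * sigma k l - sigma i k * sigma j l,
                sigma i l * sigma j k - sigma i k * sigma j l}))
           (one_factor_ideal A B) \<and>
         (\<forall>i j k l. 1 \<le> i \<and> i < j \<and> j < k \<and> k < l \<and> l \<le> card A \<longrightarrow>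
            lead_term r (sigma i j * sigma k l - sigma i k * sigma j l) = sigma i j * sigma k l \<and>
            lead_term r (sigma i l * sigma j k - sigma i k * sigma j l) = sigma i l * sigma j k)"
proof -
  define n where "n = card A"
  have A: "A = {1..n}" and B: "B = {n + 1..p}" using assms(3,4) by (simp_all add: n_def)
  have "card A \<le> card {1..p}" using assms(1) by (intro card_mono) auto
  then have np: "n \<le> p" by (simp add: n_def)
  have sigma: "sigma i j = Poly_Mapping.single (edge_mon i j) 1" if "i < j" for i j
    using that by (simp add: sigma_def edge_mon_def)
  have "{sigma i j | i j. (i, j) \<in> edges {1..p} \<and> (i \<in> B \<or> j \<in> B)} =
      (\<lambda>(i, j). sigma i j) ` (edges {1..p} - edges {1..n})"
    unfolding B by (force simp: edges_def)
  also have "\<dots> = (\<lambda>(i, j). Poly_Mapping.single (edge_mon i j) 1) ` (edges {1..p} - edges {1..n})"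
    by (intro image_cong refl) (auto simp: sigma edges_def)
  finally have linear: "{sigma i j | i j. (i, j) \<in> edges {1..p} \<and> (i \<in> B \<or> j \<in> B)} =
      (\<lambda>(i, j). Poly_Mapping.single (edge_mon i j) 1) ` (edges {1..p} - edges {1..n})" .
  have lead: "lead_term r (monomial_diff s t) = Poly_Mapping.single s 1" if "(s, t) \<in> tetrad_terms n" for s t
    using lead_monomial_diff[OF circular_term_order_is_term_order[OF assms(5)]
        tetrad_terms_less[OF assms(5) that np] tetrad_lead_ne_trail[OF that that]]
    by (simp add: lead_term_def)
  have "lead_term r (sigma i j * sigma k l - sigma i k * sigma j l) = sigma i j * sigma k l \<and>
      lead_term r (sigma i l * sigma j k - sigma i k * sigma j l) = sigma i l * sigma j k"
    if "1 \<le> i" "i < j" "j < k" "k < l" "l \<le> n" for i j k l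
    using lead[OF tetrad_terms.disjoint[OF that]] lead[OF tetrad_terms.nested[OF that]] that
    by (simp add: sigma_mult_sigma monomial_diff_def)
  then show ?thesis
    using reduced_groebner_basis_one_factor[OF assms(5) np]
    unfolding linear tetrads_eq n_def[symmetric] A[symmetric] B[symmetric] by blast
qed

end
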